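(* Let $n$ and $k$ be positive integers, let $A_{n-1}$ be the symmetric group on $[n]$, and let $c=(1\,2\cdots n)$. The map $NC^{(k)}(A_{n-1})\to NC^{(k)}(n)$ given by $$(\pi_1,\ldots,\pi_k)\mapsto K^{-1}\Big\langle K^{\{\pi_2\}}(\{\pi_1\}),\ \ldots,\ K^{\{\pi_k\}}(\{\pi_{k-1}\}),\ K(\{\pi_k\})\Big\rangle$$ is an isomorphism of posets from the $k$-divisible noncrossing partitions $NC^{(k)}(A_{n-1})$ of the symmetric group to the classical $k$-divisible noncrossing partitions $NC^{(k)}(n)$. (Here the outer $K^{-1}$ is the inverse of the Kreweras complement on $NC(kn)$, and the inner $K$ is the Kreweras complement on $NC(n)$.)
   Context: Algebraic side: let $T$ be the set of transpositions of the symmetric group $A_{n-1}$ on $[n]=\{1,\ldots,n\}$, $\ell_T$ the word length with respect to $T$, and $\pi\leq_T\mu\iff\ell_T(\mu)=\ell_T(\pi)+\ell_T(\pi^{-1}\mu)$. Permutations are multiplied right to left. Fix $c=(1\,2\cdots n)$ and $NC(A_{n-1})=\{w:1\leq_Tw\leq_Tc\}$. $NC^{(k)}(A_{n-1})$ is the set of sequences $\pi_1\leq_T\cdots\leq_T\pi_k$ in $NC(A_{n-1})$, with $(\pi)_k\leq(\mu)_k$ iff $\mu_i^{-1}\mu_{i+1}\leq_T\pi_i^{-1}\pi_{i+1}$ for $1\leq i\leq k$ ($\pi_{k+1}=\mu_{k+1}=c$). For a permutation $\pi$, $\{\pi\}$ denotes the set partition of $[n]$ into orbits of $\pi$; $\pi\mapsto\{\pi\}$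 is an isomorphism $NC(A_{n-1})\to NC(n)$. Classical side: a partition of $[n]$ is noncrossing if there are no $a<b<c<d$ with $a,c$ in one block and $b,d$ in a different block. $NC(n)$ is the lattice of noncrossing partitions of $[n]$ under refinement. $NC^{(k)}(n)$ is the induced subposet of $NC(kn)$ of partitions all of whose blocks have cardinality divisible by $k$. Kreweras complement: for $\mathcal P\in NC(n)$, $K(\mathcal P)$ is the coarsest partition $\mathcal Q$ of $[n]$ such that the partition $(2\mathcal P-1)\cup(2\mathcal Q)$ of $[2n]$ is noncrossing (translations and dilations are applied elementwise to blocks). $K$ is an anti-automorphism of $NC(n)$. For a finite set $X$ of integers, $K_X$ is the Kreweras complement on noncrossing partitions of $X$, transported along the order-preserving bijection $X\leftrightarrow[|X|]$. For $\mathcal P\leq\mathcal N=\{N_1,\ldots,N_t\}$ in $NC(n)$, $K^{\mathcal N}(\mathcal P)=\bigcup_{i=1}^tK_{N_i}(\mathcal P|_{N_i})$, where $\mathcal P|_{N_i}$ is the restriction. Shuffle: for partitions $\mathcal Q_1,\ldots,\mathcal Q_k$ of $[n]$, $\langle\mathcal Q_1,\ldots,\mathcal Q_k\rangle=\bigcup_{i=1}^k(k\mathcal Q_i-(k-i))$, a partition of $[kn]$. *)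

theory Defs
  imports "HOL-Combinatorics.Combinatorics" "HOL-Library.Disjoint_Sets"
begin

definition poset_iso ::
  "'a set \<Rightarrow> ('a \<Rightarrow> 'a \<Rightarrow> bool) \<Rightarrow> 'b set \<Rightarrow> ('b \<Rightarrow> 'b \<Rightarrow> bool) \<Rightarrow> ('a \<Rightarrow> 'b) \<Rightarrow> bool" where
  "poset_iso A leA B leB f \<longleftrightarrow>
     partial_order_on A {(x, y). x \<in> A \<and> y \<in> A \<and> leA x y} \<and>
     partial_order_on B {(x, y). x \<in> B \<and> y \<in> B \<and> leB x y} \<and>
     bij_betw f A B \<and>
     (\<forall>x\<in>A. \<forall>y\<in>A. leA x y \<longleftrightarrow> leB (f x) (f y))"


section \<open>Permutations and the absolute order\<close>

text \<open>Elements of the symmetric group on \<open>{1..n}\<close> are functions \<open>w\<close> with \<open>w permutes {1..n}\<close>;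
  the product of \<open>u\<close> and \<open>v\<close>, multiplied right to left, is \<open>u \<circ> v\<close>.\<close>

definition transpositions :: "nat \<Rightarrow> (nat \<Rightarrow> nat) set" where
  "transpositions n = {transpose i j | i j. i \<in> {1..n} \<and> j \<in> {1..n} \<and> i \<noteq> j}"

definition word_length :: "nat \<Rightarrow> (nat \<Rightarrow> nat) \<Rightarrow> nat" where
  "word_length n w =
     (LEAST m. \<exists>ts. length ts = m \<and> set ts \<subseteq> transpositions n \<and> foldr (\<circ>) ts id = w)"

definition abs_le :: "nat \<Rightarrow> (nat \<Rightarrow> nat) \<Rightarrow> (nat \<Rightarrow> nat) \<Rightarrow> bool" where
  "abs_le n \<pi> \<mu> \<longleftrightarrow> word_length n \<mu> = word_length n \<pi> + word_length n (inv \<pi> \<circ> \<mu>)"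

definition coxeter :: "nat \<Rightarrow> nat \<Rightarrow> nat" where
  "coxeter n = cycle_of_list [1..<Suc n]"

definition NC_perm :: "nat \<Rightarrow> (nat \<Rightarrow> nat) set" where
  "NC_perm n = {w. w permutes {1..n} \<and> abs_le n id w \<and> abs_le n w (coxeter n)}"

text \<open>A sequence \<open>\<pi>\<^sub>1, \<dots>, \<pi>\<^sub>k\<close> is the list \<open>ps\<close> with \<open>\<pi>\<^sub>i = ps ! (i - 1)\<close>.\<close>

definition NC_perm_multichains :: "nat \<Rightarrow> nat \<Rightarrow> (nat \<Rightarrow> nat) list set" where
  "NC_perm_multichains n k =
     {ps. length ps = k \<and> set ps \<subseteq> NC_perm n \<and>
          (\<forall>i. Suc i < k \<longrightarrow> abs_le n (ps ! i) (ps ! Suc i))}"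

definition delta :: "nat \<Rightarrow> (nat \<Rightarrow> nat) list \<Rightarrow> nat \<Rightarrow> (nat \<Rightarrow> nat)" where
  "delta n ps i = inv ((ps @ [coxeter n]) ! i) \<circ> (ps @ [coxeter n]) ! Suc i"

definition NC_perm_multichains_le ::
  "nat \<Rightarrow> nat \<Rightarrow> (nat \<Rightarrow> nat) list \<Rightarrow> (nat \<Rightarrow> nat) list \<Rightarrow> bool" where
  "NC_perm_multichains_le n k ps qs \<longleftrightarrow> (\<forall>i<k. abs_le n (delta n qs i) (delta n ps i))"

definition orbit_partition :: "nat \<Rightarrow> (nat \<Rightarrow> nat) \<Rightarrow> nat set set" where
  "orbit_partition n \<pi> = orbit \<pi> ` {1..n}"


section \<open>Classical noncrossing partitions\<close>

definition noncrossing :: "nat set set \<Rightarrow> bool" where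
  "noncrossing P \<longleftrightarrow>
     \<not> (\<exists>a b c d. \<exists>B\<in>P. \<exists>B'\<in>P. a < b \<and> b < c \<and> c < d \<and> B \<noteq> B' \<and>
          a \<in> B \<and> c \<in> B \<and> b \<in> B' \<and> d \<in> B')"

definition NC :: "nat \<Rightarrow> nat set set set" where
  "NC n = {P. partition_on {1..n} P \<and> noncrossing P}"

definition NC_div :: "nat \<Rightarrow> nat \<Rightarrow> nat set set set" where
  "NC_div n k = {P \<in> NC (k * n). \<forall>B\<in>P. k dvd card B}"

definition interleave :: "nat set set \<Rightarrow> nat set set \<Rightarrow> nat set set" where
  "interleave P Q = (\<lambda>B. (\<lambda>x. 2 * x - 1) ` B) ` P \<union> (\<lambda>B. (\<lambda>x. 2 * x) ` B) ` Q"

definition kreweras :: "nat \<Rightarrow> nat set set \<Rightarrow> nat set set" where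
  "kreweras n P =
     (THE Q. partition_on {1..n} Q \<and> noncrossing (interleave P Q) \<and>
        (\<forall>R. partition_on {1..n} R \<and> noncrossing (interleave P R) \<longrightarrow> refines {1..n} R Q))"

definition kreweras_inv :: "nat \<Rightarrow> nat set set \<Rightarrow> nat set set" where
  "kreweras_inv n = the_inv_into (NC n) (kreweras n)"

text \<open>The order-preserving bijection from \<open>{1..card X}\<close> to the finite set \<open>X\<close>.\<close>

definition nth_elem :: "nat set \<Rightarrow> nat \<Rightarrow> nat" where
  "nth_elem X i = sorted_list_of_set X ! (i - 1)"

definition kreweras_on :: "nat set \<Rightarrow> nat set set \<Rightarrow> nat set set" where
  "kreweras_on X P =
     (\<lambda>B. nth_elem X ` B) `
       kreweras (card X) ((\<lambda>B. the_inv_into {1..card X} (nth_elem X) ` B) ` P)"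

definition kreweras_rel :: "nat set set \<Rightarrow> nat set set \<Rightarrow> nat set set" where
  "kreweras_rel \<N> P = (\<Union>N\<in>\<N>. kreweras_on N ((\<inter>) N ` P - {{}}))"

text \<open>The partition \<open>Q\<^sub>i\<close> is \<open>Qs ! (i - 1)\<close>.  The truncated subtractions are genuine ones, since
  \<open>i \<le> k\<close> and \<open>x \<ge> 1\<close> for elements \<open>x\<close> of blocks.\<close>

definition shuffle :: "nat set set list \<Rightarrow> nat set set" where
  "shuffle Qs =
     (let k = length Qs
      in \<Union>i\<in>{1..k}. (\<lambda>B. (\<lambda>x. k * x - (k - i)) ` B) ` (Qs ! (i - 1)))"

definition multichain_to_NC_div :: "nat \<Rightarrow> nat \<Rightarrow> (nat \<Rightarrow> nat) list \<Rightarrow> nat set set" where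
  "multichain_to_NC_div n k ps =
     kreweras_inv (k * n)
       (shuffle
         (map (\<lambda>i. kreweras_rel (orbit_partition n (ps ! Suc i)) (orbit_partition n (ps ! i)))
              [0..<k - 1]
          @ [kreweras n (orbit_partition n (ps ! (k - 1)))]))"

end

theory Submission
  imports Defs
begin

text \<open>
  A partition of \<open>[n]\<close> is replaced throughout by the permutation that sends every point to the
  cyclically next point of its block. For \<open>\<pi> \<le>\<^sub>T \<mu> \<le>\<^sub>T c\<close> the (relative) Kreweras complement then is
  a quotient, \<open>K\<^sup>{\<^sup>\<mu>\<^sup>}({\<pi>}) = {\<pi>\<^sup>-\<^sup>1 \<mu>}\<close>, and with \<open>\<delta>\<^sub>i = \<pi>\<^sub>i\<^sup>-\<^sup>1 \<pi>\<^sub>i\<^sub>+\<^sub>1\<close>, \<open>\<pi>\<^sub>k\<^sub>+\<^sub>1 = c\<close>, the map of the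
  theorem sends a multichain to \<open>{C \<sigma>\<^sup>-\<^sup>1}\<close>, where \<open>C\<close> is the long cycle on \<open>[kn]\<close> and \<open>\<sigma>\<close> is the
  shuffle of \<open>\<delta>\<^sub>1, \<dots>, \<delta>\<^sub>k\<close>, the permutation of \<open>[kn]\<close> that acts as \<open>\<delta>\<^sub>i\<close> on the numbers congruent to
  \<open>i\<close> modulo \<open>k\<close>.

  Everything rests on two facts. The first is that \<open>w \<le>\<^sub>T c\<close> is a local condition: between \<open>x\<close> and
  \<open>w x\<close>, in the cyclic order, there are only complete cycles of \<open>w\<close> (\<open>planar\<close>,
  \<open>NC_perm_iff\<close>). Multiplication by a transposition splits or merges cycles, so that \<open>\<ell>\<^sub>T\<close> is
  \<open>n\<close> minus the number of cycles and going down in the absolute order means splitting cycles.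
  Splitting preserves the local condition (\<open>planar_split\<close>); conversely, if two permutations satisfy
  it and the orbits of \<open>u\<close> refine those of \<open>v\<close>, then \<open>v\<close> can be split step by step until it becomes
  \<open>u\<close> (\<open>planar_abs_le\<close>). It follows that \<open>\<pi> \<mapsto> {\<pi>}\<close> is an isomorphism onto the noncrossing partitions.

  The second fact concerns the shuffle \<open>\<sigma>\<close> of arbitrary permutations \<open>d\<^sub>1, \<dots>, d\<^sub>k\<close> of \<open>[n]\<close>. The
  permutation \<open>\<sigma>\<^sup>-\<^sup>1 C\<close> moves through the residue classes cyclically, and \<open>k\<close> steps of it amount
  to one step of \<open>(d\<^sub>1 \<cdots> d\<^sub>k)\<^sup>-\<^sup>1 c\<close>, so these two permutations have equally many cycles
  (\<open>cycles_rot\<close>). Counting cycles shows that \<open>\<sigma>\<close> is noncrossing iff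
  \<open>\<ell>\<^sub>T(d\<^sub>1) + \<cdots> + \<ell>\<^sub>T(d\<^sub>k) + \<ell>\<^sub>T((d\<^sub>1 \<cdots> d\<^sub>k)\<^sup>-\<^sup>1 c) = \<ell>\<^sub>T(c)\<close> (\<open>shuffle_perm_in_NC_perm_iff\<close>). For \<open>k = 2\<close>
  this is the description of the Kreweras complement as \<open>w\<^sup>-\<^sup>1 c\<close> (\<open>kreweras_orbit_partition\<close>), from
  which the relative version follows in the coordinates of the single blocks. For general \<open>k\<close> it says
  that \<open>\<sigma>\<close> is noncrossing iff the \<open>d\<^sub>i\<close> are the quotients \<open>\<delta>\<^sub>i\<close> of a multichain: the sum is at least
  \<open>\<ell>\<^sub>T(c)\<close> in any case, and the partial products give the multichain when it is equal.

  Finally, all cycle lengths of a noncrossing permutation \<open>w\<close> of \<open>[kn]\<close> are divisible by \<open>k\<close> iff \<open>w\<close>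
  raises residues modulo \<open>k\<close> by one, and this holds iff \<open>w\<^sup>-\<^sup>1 C\<close> preserves residues, i.e. is a shuffle.
  This gives bijectivity. For the order, taking complements is antitone, and one shuffle refines
  another iff all its components do.
\<close>

section \<open>Orbits and transpositions\<close>

lemma permutation_of_permutes [intro]: "w permutes {1..n::nat} \<Longrightarrow> permutation w"
  by (auto simp: permutation_permutes)

lemma orbit_eq_iff_mem:
  assumes "permutation w"
  shows "orbit w x = orbit w y \<longleftrightarrow> x \<in> orbit w y"
proof
  show "x \<in> orbit w y" if "orbit w x = orbit w y"
    using permutation_self_in_orbit[OF assms, of x] that by simp
  show "orbit w x = orbit w y" if "x \<in> orbit w y"
    using orbit_cyclic_eq3[OF cyclic_on_orbit'[OF assms] that] .
qed

lemma mem_orbit_commute: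
  assumes "permutation w"
  shows "x \<in> orbit w y \<longleftrightarrow> y \<in> orbit w x"
  using orbit_eq_iff_mem[OF assms] by metis

lemma orbit_subset_invariant:
  assumes "x \<in> S" "w ` S \<subseteq> S"
  shows "orbit w x \<subseteq> S"
proof
  fix y assume "y \<in> orbit w x"
  then show "y \<in> S" by induct (use assms in auto)
qed

lemma invariant_mem_iff:
  assumes "permutation w" "w ` S \<subseteq> S"
  shows "w x \<in> S \<longleftrightarrow> x \<in> S"
proof
  assume "w x \<in> S"
  then have "orbit w (w x) \<subseteq> S" using assms(2) by (rule orbit_subset_invariant)
  then show "x \<in> S"
    using permutation_orbit_step[OF assms(1)] permutation_self_in_orbit[OF assms(1)] by blast
qed (use assms(2) in auto)

lemma invariant_orbit_mem_iff:
  assumes "permutation w" "w ` S \<subseteq> S" "y \<in> orbit w x"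
  shows "y \<in> S \<longleftrightarrow> x \<in> S"
  using orbit_subset_invariant[OF _ assms(2)] assms(3) mem_orbit_commute[OF assms(1)] by blast

lemma finite_orbit_permutation: "permutation w \<Longrightarrow> finite (orbit w x)"
  by (intro finite_orbit permutation_self_in_orbit)

text \<open>Following \<open>v\<close> from \<open>v a\<close>, the first of the points \<open>a\<close>, \<open>b\<close> to be met is \<open>b\<close>; up to there
  \<open>v \<circ> (a b)\<close>, started at \<open>b\<close>, takes the same steps.\<close>

lemma not_in_orbit_split:
  assumes v: "permutation v" and ab: "a \<noteq> b" "b \<in> orbit v a"
  shows "a \<notin> orbit (v \<circ> transpose a b) b"
proof -
  define u where "u = v \<circ> transpose a b"
  have step: "u y = v (transpose a b y)" for y by (simp add: u_def)
  define d where "d = funpow_dist1 v a b"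
  have vd: "(v ^^ d) a = b" unfolding d_def using ab(2) by (rule funpow_dist1_prop)
  have d0: "d > 0" by (simp add: d_def)
  have nb: "(v ^^ i) a \<noteq> b" if "0 < i" "i < d" for i
    using that funpow_dist1_least unfolding d_def by metis
  have na: "(v ^^ i) a \<noteq> a" if i: "0 < i" "i < d" for i
  proof
    assume e: "(v ^^ i) a = a"
    have "(v ^^ (d - i)) a = (v ^^ (d - i)) ((v ^^ i) a)" using e by simp
    also have "\<dots> = b" using vd i by (metis add.commute funpow_add le_add_diff_inverse less_imp_le_nat o_apply)
    finally show False using nb[of "d - i"] i by simp
  qed
  have u': "(u ^^ i) b = (v ^^ i) a" if "0 < i" "i \<le> d" for i
    using that
  proof (induction i)
    case (Suc i)
    show ?case
    proof (cases "i = 0")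
      case False
      then have "(u ^^ i) b = (v ^^ i) a" using Suc.IH Suc.prems by linarith
      moreover have "transpose a b ((v ^^ i) a) = (v ^^ i) a"
        using na[of i] nb[of i] False Suc.prems by (simp add: transpose_apply_other)
      moreover have "(u ^^ Suc i) b = u ((u ^^ i) b)" by simp
      ultimately show ?thesis using step[of "(v ^^ i) a"] by simp
    qed (simp add: step)
  qed simp
  have "(u ^^ d) b = b" using u'[of d] d0 vd by simp
  then have "orbit u b = {(u ^^ m) b | m. m < d}" using d0 by (rule orbit_altdef_bounded)
  moreover have "(u ^^ m) b \<noteq> a" if "m < d" for m
    using u'[of m] na[of m] that ab(1) by (cases "m = 0") auto
  ultimately have "a \<notin> orbit u b" by auto
  then show ?thesis unfolding u_def .
qed

lemma orbit_split:
  assumes v: "permutation v" and ab: "a \<noteq> b" "b \<in> orbit v a"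
  defines "u \<equiv> v \<circ> transpose a b"
  shows "orbit v a = orbit u a \<union> orbit u b"
    and "orbit u a \<inter> orbit u b = {}"
    and "x \<notin> orbit v a \<Longrightarrow> orbit u x = orbit v x"
    and "orbit u x \<subseteq> orbit v x"
proof -
  have u: "permutation u" unfolding u_def by (intro permutation_compose v permutation_swap_id)
  have a: "a \<in> orbit v a" by (rule permutation_self_in_orbit[OF v])
  have sw: "u a = v b" "u b = v a" "\<And>y. y \<noteq> a \<Longrightarrow> y \<noteq> b \<Longrightarrow> u y = v y"
    by (auto simp: u_def transpose_def)
  have cl: "u ` orbit v x \<subseteq> orbit v x" for x
  proof clarify
    fix y assume y: "y \<in> orbit v x"
    have "transpose a b y \<in> orbit v x"
      using y a ab(2) orbit_eq_iff_mem[OF v, of y x] orbit_eq_iff_mem[OF v, of a x]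
        orbit_eq_iff_mem[OF v, of b x] orbit_eq_iff_mem[OF v, of b a]
      by (cases "y = a"; cases "y = b") auto
    then show "u y \<in> orbit v x" unfolding u_def by (auto intro: orbit.step)
  qed
  show sub: "orbit u x \<subseteq> orbit v x" for x
    using permutation_self_in_orbit[OF v] cl by (rule orbit_subset_invariant)
  have "v ` (orbit u a \<union> orbit u b) \<subseteq> orbit u a \<union> orbit u b"
  proof clarify
    fix y assume "y \<in> orbit u a \<union> orbit u b" "v y \<notin> orbit u b"
    moreover have "v a \<in> orbit u b" "v b \<in> orbit u a"
      using orbit.base[of u a] orbit.base[of u b] sw(1,2) by simp_all
    moreover have "v y \<in> orbit u z" if "y \<noteq> a" "y \<noteq> b" "y \<in> orbit u z" for z
      using orbit.step[OF that(3)] sw(3)[OF that(1,2)] by simp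
    ultimately show "v y \<in> orbit u a" by blast
  qed
  then have "orbit v a \<subseteq> orbit u a \<union> orbit u b"
    by (intro orbit_subset_invariant) (auto simp: permutation_self_in_orbit[OF u])
  moreover have "orbit v b = orbit v a" using orbit_eq_iff_mem[OF v] ab(2) by simp
  ultimately show "orbit v a = orbit u a \<union> orbit u b" using sub[of a] sub[of b] by auto
  show "orbit u a \<inter> orbit u b = {}"
    using not_in_orbit_split[OF v ab] orbit_eq_iff_mem[OF u] mem_orbit_commute[OF u]
    unfolding u_def by blast
  show "orbit u x = orbit v x" if "x \<notin> orbit v a"
  proof (rule orbit_cong[OF permutation_self_in_orbit[OF v]])
    fix s assume "s \<in> orbit v x"
    then have "s \<notin> orbit v a" using that orbit_eq_iff_mem[OF v] by metis
    then have "s \<noteq> a" "s \<noteq> b" using a ab(2) by auto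
    then show "u s = v s" by (rule sw(3))
  qed
qed

text \<open>If \<open>a\<close> and \<open>b\<close> were still in different orbits of \<open>v \<circ> (a b)\<close>, then following \<open>v\<close> from
  \<open>v b\<close> until it returns to \<open>b\<close> would be following \<open>v \<circ> (a b)\<close> from \<open>a\<close> to \<open>b\<close>.\<close>

lemma in_orbit_merge:
  assumes v: "permutation v" and b: "b \<notin> orbit v a"
  shows "b \<in> orbit (v \<circ> transpose a b) a"
proof -
  define u where "u = v \<circ> transpose a b"
  have step: "u y = v (transpose a b y)" for y by (simp add: u_def)
  have bb: "b \<in> orbit v b" using v by (rule permutation_self_in_orbit)
  define d where "d = funpow_dist1 v b b"
  have vd: "(v ^^ d) b = b" unfolding d_def using bb by (rule funpow_dist1_prop)
  have nb: "(v ^^ i) b \<noteq> b" if "0 < i" "i < d" for i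
    using that funpow_dist1_least unfolding d_def by metis
  have na: "(v ^^ i) b \<noteq> a" for i
    using b mem_orbit_commute[OF v, of b a] orbit_altdef_permutation[OF v, of b] by blast
  have "(u ^^ i) a = (v ^^ i) b" if "0 < i" "i \<le> d" for i
    using that
  proof (induction i)
    case (Suc i)
    show ?case
    proof (cases "i = 0")
      case False
      then have "(u ^^ i) a = (v ^^ i) b" using Suc.IH Suc.prems by linarith
      moreover have "transpose a b ((v ^^ i) b) = (v ^^ i) b"
        using na[of i] nb[of i] False Suc.prems by (simp add: transpose_apply_other)
      moreover have "(u ^^ Suc i) a = u ((u ^^ i) a)" by simp
      ultimately show ?thesis using step[of "(v ^^ i) b"] by simp
    qed (simp add: step)
  qed simp
  from this[of d] vd have "(u ^^ d) a = b" "0 < d" by (simp_all add: d_def)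
  then have "b \<in> orbit u a" unfolding orbit_altdef by blast
  then show ?thesis unfolding u_def .
qed


section \<open>The absolute length counts cycles\<close>

definition cycles :: "nat \<Rightarrow> (nat \<Rightarrow> nat) \<Rightarrow> nat" where
  "cycles n w = card (orbit_partition n w)"

lemma finite_orbit_partition [simp]: "finite (orbit_partition n w)"
  by (simp add: orbit_partition_def)

lemma orbit_partition_mem: "x \<in> {1..n} \<Longrightarrow> orbit w x \<in> orbit_partition n w"
  by (auto simp: orbit_partition_def)

lemma partition_on_orbit_partition:
  assumes "w permutes {1..n}"
  shows "partition_on {1..n} (orbit_partition n w)"
proof (rule partition_onI)
  have w: "permutation w" using assms by auto
  show "\<Union> (orbit_partition n w) = {1..n}"
    using permutes_orbit_subset[OF assms] permutation_self_in_orbit[OF w]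
    by (fastforce simp: orbit_partition_def)
  show "{} \<notin> orbit_partition n w"
    using orbit_nonempty by (force simp: orbit_partition_def)
  show "disjnt p q" if "p \<in> orbit_partition n w" "q \<in> orbit_partition n w" "p \<noteq> q" for p q
  proof -
    obtain x y where "p = orbit w x" "q = orbit w y"
      using \<open>p \<in> _\<close> \<open>q \<in> _\<close> by (auto simp: orbit_partition_def)
    then show ?thesis using \<open>p \<noteq> q\<close> orbit_eq_iff_mem[OF w] unfolding disjnt_iff by metis
  qed
qed

lemma cycles_split:
  assumes v: "v permutes {1..n}" and ab: "a \<in> {1..n}" "a \<noteq> b" "b \<in> orbit v a"
  shows "cycles n (v \<circ> transpose a b) = Suc (cycles n v)"
proof -
  define u where "u = v \<circ> transpose a b"
  have pv: "permutation v" using v by auto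
  have b: "b \<in> {1..n}" using permutes_orbit_subset[OF v ab(1)] ab(3) by blast
  have pu: "permutation u" unfolding u_def by (intro permutation_compose pv permutation_swap_id)
  note s = orbit_split[OF pv ab(2,3), folded u_def]
  let ?R = "orbit_partition n v - {orbit v a}"
  have R: "\<exists>x\<in>{1..n}. x \<notin> orbit v a \<and> O' = orbit v x" if "O' \<in> ?R" for O'
    using that orbit_eq_iff_mem[OF pv] by (auto simp: orbit_partition_def)
  have "orbit_partition n u = insert (orbit u a) (insert (orbit u b) ?R)"
  proof (intro equalityI subsetI)
    fix O' assume "O' \<in> orbit_partition n u"
    then obtain x where x: "x \<in> {1..n}" "O' = orbit u x" by (auto simp: orbit_partition_def)
    show "O' \<in> insert (orbit u a) (insert (orbit u b) ?R)"
    proof (cases "x \<in> orbit v a")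
      case True
      then show ?thesis using s(1) x(2) orbit_eq_iff_mem[OF pu] by auto
    next
      case False
      then have "orbit v x \<noteq> orbit v a" using orbit_eq_iff_mem[OF pv] by simp
      then show ?thesis using False s(3) x by (auto simp: orbit_partition_def)
    qed
  next
    fix O' assume "O' \<in> insert (orbit u a) (insert (orbit u b) ?R)"
    then show "O' \<in> orbit_partition n u"
      using ab(1) b R[of O'] s(3) orbit_partition_mem by (metis insert_iff)
  qed
  moreover have "orbit u a \<noteq> orbit u b" using s(2) orbit_nonempty[of u a] by auto
  moreover have "orbit u b \<notin> ?R" "orbit u a \<notin> ?R"
    using R s(1) permutation_self_in_orbit[OF pu] permutation_self_in_orbit[OF pv]
      orbit_eq_iff_mem[OF pv] by (metis UnCI)+
  ultimately have "card (orbit_partition n u) = Suc (Suc (card ?R))" by simp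
  also have "Suc (card ?R) = card (orbit_partition n v)"
    using orbit_partition_mem[OF ab(1)] by (intro card_Suc_Diff1) auto
  finally show ?thesis unfolding cycles_def u_def .
qed

lemma comp_transpose_twice: "v \<circ> transpose a b \<circ> transpose a b = v"
  by (auto simp: fun_eq_iff)

lemma permutes_comp_transpose:
  assumes "v permutes {1..n::nat}" "a \<in> {1..n}" "b \<in> {1..n}"
  shows "(v \<circ> transpose a b) permutes {1..n}"
  using assms by (intro permutes_compose permutes_swap_id)

lemma cycles_merge:
  assumes v: "v permutes {1..n}" and ab: "a \<in> {1..n}" "b \<in> {1..n}" "b \<notin> orbit v a"
  shows "Suc (cycles n (v \<circ> transpose a b)) = cycles n v"
proof -
  have pv: "permutation v" using v by auto
  have "b \<in> orbit (v \<circ> transpose a b) a" using in_orbit_merge[OF pv ab(3)] .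
  moreover have "a \<noteq> b" using ab(3) permutation_self_in_orbit[OF pv] by auto
  ultimately show ?thesis
    using cycles_split[OF permutes_comp_transpose[OF v ab(1,2)] ab(1)] comp_transpose_twice by metis
qed

lemma cycles_transpose_ge:
  assumes v: "v permutes {1..n}" and ab: "a \<in> {1..n}" "b \<in> {1..n}" "a \<noteq> b"
  shows "cycles n v \<le> Suc (cycles n (v \<circ> transpose a b))"
  using cycles_split[OF v ab(1,3)] cycles_merge[OF v ab(1,2)] by fastforce

lemma orbit_id: "orbit id x = {x}"
  by (simp add: orbit_eq_singleton_iff)

lemma cycles_id: "cycles n id = n"
proof -
  have "orbit_partition n id = (\<lambda>x. {x}) ` {1..n}"
    by (simp add: orbit_partition_def orbit_id)
  then show ?thesis by (simp add: cycles_def card_image)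
qed

lemma cycles_le: "cycles n w \<le> n"
  unfolding cycles_def orbit_partition_def
  using card_image_le[of "{1..n}" "orbit w"] by simp

definition prod_perm :: "('a \<Rightarrow> 'a) list \<Rightarrow> 'a \<Rightarrow> 'a" where
  "prod_perm ts = foldr (\<circ>) ts id"

lemma prod_perm_simps [simp]:
  "prod_perm [] = id"
  "prod_perm (t # ts) = t \<circ> prod_perm ts"
  by (simp_all only: prod_perm_def foldr.simps o_apply id_apply)

lemma prod_perm_append [simp]: "prod_perm (ts @ ts') = prod_perm ts \<circ> prod_perm ts'"
  by (induction ts) (simp_all add: o_assoc)

lemma prod_perm_permutes:
  assumes "\<And>t. t \<in> set ts \<Longrightarrow> t permutes S"
  shows "prod_perm ts permutes S"
  using assms by (induction ts) (simp_all add: permutes_id permutes_compose)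

lemma transposition_permutes: "t \<in> transpositions n \<Longrightarrow> t permutes {1..n}"
  unfolding transpositions_def by (auto intro: permutes_swap_id)

text \<open>A letter changes the number of cycles by at most one, and a transposition of a moved point
  \<open>a\<close> with \<open>w a\<close> raises it; so the shortest words have length \<open>n\<close> minus the number of cycles.\<close>

lemma length_word_ge:
  assumes "set ts \<subseteq> transpositions n"
  shows "n \<le> length ts + cycles n (prod_perm ts)"
  using assms
proof (induction ts rule: rev_induct)
  case (snoc t ts)
  obtain a b where t: "t = transpose a b" "a \<in> {1..n}" "b \<in> {1..n}" "a \<noteq> b"
    using snoc.prems by (auto simp: transpositions_def)
  have "cycles n (prod_perm ts) \<le> Suc (cycles n (prod_perm ts \<circ> t))"
    unfolding t(1) using snoc.prems t by (intro cycles_transpose_ge prod_perm_permutes) (use transposition_permutes in auto)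
  also have "prod_perm ts \<circ> t = prod_perm (ts @ [t])" by simp
  finally have "cycles n (prod_perm ts) \<le> Suc (cycles n (prod_perm (ts @ [t])))" .
  moreover have "n \<le> length ts + cycles n (prod_perm ts)" using snoc by simp
  ultimately have "n \<le> length ts + Suc (cycles n (prod_perm (ts @ [t])))"
    by linarith
  then show ?case by (simp del: prod_perm_append)
qed (simp add: cycles_id)

lemma exists_word:
  assumes "w permutes {1..n}"
  shows "\<exists>ts. set ts \<subseteq> transpositions n \<and> prod_perm ts = w \<and> length ts = n - cycles n w"
  using assms
proof (induction "n - cycles n w" arbitrary: w rule: less_induct)
  case less
  show ?case
  proof (cases "w = id")
    case True
    then show ?thesis by (intro exI[of _ "[]"]) (simp add: cycles_id)
  next
    case False
    then obtain a where a: "w a \<noteq> a" by (auto simp: fun_eq_iff)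
    have ain: "a \<in> {1..n}" using a permutes_not_in[OF less.prems] by blast
    then have win: "w a \<in> {1..n}" using permutes_in_image[OF less.prems] by blast
    let ?u = "w \<circ> transpose a (w a)"
    have u: "?u permutes {1..n}" using permutes_comp_transpose[OF less.prems ain win] .
    have c: "cycles n ?u = Suc (cycles n w)"
      using a by (intro cycles_split less.prems ain orbit.base) auto
    with cycles_le[of n ?u] have "n - cycles n ?u < n - cycles n w" by simp
    from less.hyps[OF this u] obtain ts where ts: "set ts \<subseteq> transpositions n"
      "prod_perm ts = ?u" "length ts = n - cycles n ?u" by blast
    have "prod_perm (ts @ [transpose a (w a)]) = w"
      using ts(2) comp_transpose_twice[of w a "w a"] by simp
    moreover have "set (ts @ [transpose a (w a)]) \<subseteq> transpositions n"
      using ts(1) a ain win unfolding transpositions_def by fastforce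
    moreover have "length (ts @ [transpose a (w a)]) = n - cycles n w"
      using ts(3) c cycles_le[of n ?u] by simp
    ultimately show ?thesis by blast
  qed
qed

lemma word_length_eq:
  assumes "w permutes {1..n}"
  shows "word_length n w = n - cycles n w"
  unfolding word_length_def prod_perm_def[symmetric]
proof (rule Least_equality)
  show "\<exists>ts. length ts = n - cycles n w \<and> set ts \<subseteq> transpositions n \<and> prod_perm ts = w"
    using exists_word[OF assms] by blast
  show "n - cycles n w \<le> m"
    if ex: "\<exists>ts. length ts = m \<and> set ts \<subseteq> transpositions n \<and> prod_perm ts = w" for m
  proof -
    obtain ts where ts: "length ts = m" "set ts \<subseteq> transpositions n" "prod_perm ts = w"
      using ex by blast
    show ?thesis using length_word_ge[OF ts(2)] unfolding ts(1,3) by simp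
  qed
qed

lemma word_length_plus_cycles:
  assumes "w permutes {1..n}"
  shows "word_length n w + cycles n w = n"
  using word_length_eq[OF assms] cycles_le[of n w] by simp

lemma word_length_id [simp]: "word_length n id = 0"
  using word_length_plus_cycles[of id n] by (simp add: cycles_id permutes_id)

lemma obtain_word:
  assumes "w permutes {1..n}"
  obtains ts where "set ts \<subseteq> transpositions n" "prod_perm ts = w" "length ts = word_length n w"
  using exists_word[OF assms] unfolding word_length_eq[OF assms] by blast

lemma word_length_le:
  assumes "set ts \<subseteq> transpositions n" "prod_perm ts = w"
  shows "word_length n w \<le> length ts"
  unfolding word_length_def prod_perm_def[symmetric] using assms by (intro Least_le) blast

lemma word_length_comp_le:
  assumes "u permutes {1..n}" "v permutes {1..n}"
  shows "word_length n (u \<circ> v) \<le> word_length n u + word_length n v"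
proof -
  obtain ts where ts: "set ts \<subseteq> transpositions n" "prod_perm ts = u" "length ts = word_length n u"
    using obtain_word[OF assms(1)] .
  obtain rs where rs: "set rs \<subseteq> transpositions n" "prod_perm rs = v" "length rs = word_length n v"
    using obtain_word[OF assms(2)] .
  show ?thesis
    using word_length_le[of "ts @ rs" n "u \<circ> v"] ts rs by simp
qed

lemma word_length_eq_0_iff:
  assumes "w permutes {1..n}"
  shows "word_length n w = 0 \<longleftrightarrow> w = id"
proof
  assume l: "word_length n w = 0"
  obtain ts where "prod_perm ts = w" "length ts = word_length n w"
    using obtain_word[OF assms] .
  then show "w = id" using l by simp
qed simp

lemma cycles_commute:
  assumes u: "u permutes {1..n}" and v: "v permutes {1..n}"
  shows "cycles n (u \<circ> v) = cycles n (v \<circ> u)"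
proof -
  have vu: "permutation (v \<circ> u)" using permutes_compose[OF u v] by auto
  have o: "u ` orbit (v \<circ> u) x = orbit (u \<circ> v) (u x)" for x
    by (rule orbit_inverse) (auto simp: permutation_self_in_orbit[OF vu])
  have "orbit_partition n (u \<circ> v) = orbit (u \<circ> v) ` (u ` {1..n})"
    using permutes_image[OF u] by (simp add: orbit_partition_def)
  also have "\<dots> = (\<lambda>B. u ` B) ` orbit_partition n (v \<circ> u)"
    using o by (simp add: orbit_partition_def image_image)
  finally show ?thesis
    unfolding cycles_def
    by (simp add: card_image inj_on_image inj_on_subset[OF permutes_inj[OF u]])
qed

lemma word_length_commute:
  assumes u: "u permutes {1..n}" and v: "v permutes {1..n}"
  shows "word_length n (u \<circ> v) = word_length n (v \<circ> u)"
  using cycles_commute[OF u v] word_length_eq permutes_compose[OF u v] permutes_compose[OF v u] by simp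


section \<open>The absolute order is generated by splitting cycles\<close>

text \<open>A reduced word \<open>t\<^sub>1 \<dots> t\<^sub>r\<close> of \<open>u\<^sup>-\<^sup>1 v\<close> gives \<open>u = v t\<^sub>r \<dots> t\<^sub>1\<close>; the number of cycles has to grow
  by \<open>r\<close> along these \<open>r\<close> multiplications, so each of them splits a cycle.\<close>

lemma abs_le_split_induct [consumes 3, case_names refl split]:
  assumes le: "abs_le n u v" and u: "u permutes {1..n}" and v: "v permutes {1..n}"
    and refl: "P v"
    and split: "\<And>w a b. w permutes {1..n} \<Longrightarrow> a \<in> {1..n} \<Longrightarrow> b \<in> {1..n} \<Longrightarrow> a \<noteq> b \<Longrightarrow>
      b \<in> orbit w a \<Longrightarrow> P w \<Longrightarrow> P (w \<circ> transpose a b)"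
  shows "P u"
proof -
  have main: "P u"
    if "set ts \<subseteq> transpositions n" "u \<circ> prod_perm ts = v" "u permutes {1..n}"
       "cycles n u = cycles n v + length ts" for ts u
    using that
  proof (induction ts arbitrary: u)
    case Nil
    then show ?case using refl by simp
  next
    case (Cons t ts)
    obtain a b where t: "t = transpose a b" "a \<in> {1..n}" "b \<in> {1..n}" "a \<noteq> b"
      using Cons.prems(1) by (auto simp: transpositions_def)
    let ?w = "u \<circ> t"
    have w: "?w permutes {1..n}" unfolding t(1) using Cons.prems(3) t by (intro permutes_comp_transpose)
    have uw: "?w \<circ> t = u" unfolding t(1) by (rule comp_transpose_twice)
    have wv: "?w \<circ> prod_perm ts = v"
      using Cons.prems(2) by (simp only: prod_perm_simps o_assoc)
    have ge: "cycles n z \<le> cycles n (z \<circ> prod_perm rs) + length rs"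
      if "set rs \<subseteq> transpositions n" "z permutes {1..n}" for rs z
      using that
    proof (induction rs arbitrary: z)
      case (Cons r rs)
      obtain c d where r: "r = transpose c d" "c \<in> {1..n}" "d \<in> {1..n}" "c \<noteq> d"
        using Cons.prems(1) by (auto simp: transpositions_def)
      have "z \<circ> r permutes {1..n}"
        unfolding r(1) using Cons.prems(2) r by (intro permutes_comp_transpose)
      from Cons.IH[OF _ this] Cons.prems(1)
      have "cycles n (z \<circ> r) \<le> cycles n (z \<circ> (r \<circ> prod_perm rs)) + length rs"
        by (simp only: o_assoc list.simps insert_subset)
      also have "z \<circ> (r \<circ> prod_perm rs) = z \<circ> prod_perm (r # rs)" by simp
      finally have "Suc (cycles n (z \<circ> r)) \<le> Suc (cycles n (z \<circ> prod_perm (r # rs)) + length rs)"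
        by (rule Suc_le_mono[THEN iffD2])
      moreover have "cycles n z \<le> Suc (cycles n (z \<circ> r))"
        unfolding r(1) using Cons.prems(2) r by (intro cycles_transpose_ge)
      ultimately have "cycles n z \<le> Suc (cycles n (z \<circ> prod_perm (r # rs)) + length rs)"
        by (rule le_trans[rotated])
      then show ?case by (simp only: list.size add_Suc_right One_nat_def add_0_right)
    qed simp
    have "cycles n ?w \<le> cycles n v + length ts"
      using ge[OF _ w, of ts] Cons.prems(1) wv by simp
    moreover have o: "b \<in> orbit ?w a"
    proof (rule ccontr)
      assume "b \<notin> orbit ?w a"
      from cycles_merge[OF w t(2,3) this] have "Suc (cycles n u) = cycles n ?w"
        using uw t(1) by simp
      then show False using calculation Cons.prems(4) by simp
    qed
    moreover have "cycles n u = Suc (cycles n ?w)"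
      using cycles_split[OF w t(2,4) o] uw t(1) by simp
    ultimately have "cycles n ?w = cycles n v + length ts" using Cons.prems(4) by simp
    from Cons.IH[OF _ wv w this] Cons.prems(1) have Pw: "P ?w" by (simp only: list.simps insert_subset)
    have "P (?w \<circ> t)" by (subst (2) t(1)) (rule split[OF w t(2-4) o Pw])
    then show ?case using uw by simp
  qed
  have iv: "inv u \<circ> v permutes {1..n}" using u v by (intro permutes_compose permutes_inv)
  obtain ts where ts: "set ts \<subseteq> transpositions n" "prod_perm ts = inv u \<circ> v"
    "length ts = word_length n (inv u \<circ> v)" using obtain_word[OF iv] .
  have "u \<circ> prod_perm ts = v" using ts(2) permutes_inv_o(1)[OF u] by (simp add: o_assoc)
  moreover have "cycles n u = cycles n v + length ts"
    using le word_length_plus_cycles[OF u] word_length_plus_cycles[OF v] ts(3) by (simp add: abs_le_def)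
  ultimately show ?thesis using main ts(1) u by blast
qed

lemma abs_le_orbit_subset:
  assumes "abs_le n u v" "u permutes {1..n}" "v permutes {1..n}"
  shows "orbit u x \<subseteq> orbit v x"
  using assms
proof (induction rule: abs_le_split_induct)
  case (split w a b)
  have "orbit (w \<circ> transpose a b) x \<subseteq> orbit w x"
    using orbit_split(4)[OF _ split(4,5)] split(1) by blast
  then show ?case using split by blast
qed simp

lemma abs_le_refl: "w permutes {1..n} \<Longrightarrow> abs_le n w w"
  by (simp add: abs_le_def permutes_inv_o)

lemma id_abs_le: "abs_le n id w"
  by (simp add: abs_le_def)

lemma abs_le_antisym:
  assumes "abs_le n u v" "abs_le n v u" "u permutes {1..n}" "v permutes {1..n}"
  shows "u = v"
proof -
  have "word_length n (inv u \<circ> v) = 0" using assms(1,2) by (simp add: abs_le_def)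
  then have "inv u \<circ> v = id"
    using assms(3,4) by (subst (asm) word_length_eq_0_iff) (auto intro: permutes_compose permutes_inv)
  then show ?thesis using permutes_inv_o(1)[OF assms(3)] by (metis comp_assoc comp_id id_comp)
qed

text \<open>A split raises the number of cycles by exactly one, so by subadditivity of the length none is lost
  on the way from \<open>u\<close> to \<open>v\<close>.\<close>

lemma abs_le_split_trans:
  assumes le: "abs_le n u (v \<circ> transpose a b)" and u: "u permutes {1..n}" and v: "v permutes {1..n}"
    and ab: "a \<in> {1..n}" "b \<in> {1..n}" "a \<noteq> b" "b \<in> orbit v a"
  shows "abs_le n u v"
proof -
  let ?t = "transpose a b" define w where "w = v \<circ> ?t"
  define p where "p = inv u \<circ> v"
  define q where "q = inv u \<circ> w"
  have w: "w permutes {1..n}" unfolding w_def using permutes_comp_transpose[OF v ab(1,2)] .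
  have iu: "inv u permutes {1..n}" using permutes_inv[OF u] .
  have t: "?t permutes {1..n}" using ab by (intro permutes_swap_id)
  have pq: "p permutes {1..n}" "q permutes {1..n}"
    unfolding p_def q_def by (intro permutes_compose iu v w)+
  have "word_length n ?t \<le> 1"
    using word_length_le[of "[?t]" n ?t] ab by (auto simp: transpositions_def)
  moreover have "q \<circ> ?t = p" by (auto simp: p_def q_def w_def fun_eq_iff)
  ultimately have "word_length n p \<le> word_length n q + 1"
    using word_length_comp_le[OF pq(2) t] by simp
  moreover have "word_length n v = Suc (word_length n w)"
    using cycles_split[OF v ab(1,3,4), folded w_def] word_length_plus_cycles[OF v]
      word_length_plus_cycles[OF w] by simp
  moreover have "u \<circ> p = v" using permutes_inv_o(1)[OF u] by (simp add: p_def o_assoc)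
  then have "word_length n v \<le> word_length n u + word_length n p"
    using word_length_comp_le[OF u pq(1)] by simp
  moreover have "word_length n w = word_length n u + word_length n q"
    using le by (simp only: abs_le_def w_def q_def)
  ultimately have "word_length n v = word_length n u + word_length n p" by linarith
  then show ?thesis by (simp only: abs_le_def p_def)
qed


section \<open>Noncrossing permutations\<close>

text \<open>For \<open>x < w x\<close> this is the cyclic interval strictly between \<open>x\<close> and \<open>w x\<close>; for \<open>w x \<le> x\<close>
  it is the complement of that cyclic interval. Invariance is insensitive to complements, so the
  distinction only serves to keep the sets intervals.\<close>

definition gap :: "(nat \<Rightarrow> nat) \<Rightarrow> nat \<Rightarrow> nat set" where
  "gap w x = (if x < w x then {x<..<w x} else {w x..x})"

definition planar :: "(nat \<Rightarrow> nat) \<Rightarrow> bool" where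
  "planar w \<longleftrightarrow> (\<forall>x. w ` gap w x \<subseteq> gap w x)"

lemma planar_orbit_gap:
  assumes "permutation w" "planar w" "z \<in> orbit w y"
  shows "z \<in> gap w x \<longleftrightarrow> y \<in> gap w x"
proof (rule invariant_orbit_mem_iff[OF assms(1) _ assms(3)])
  show "w ` gap w x \<subseteq> gap w x" using assms(2) by (simp only: planar_def)
qed

lemma planar_gap_iff:
  assumes "permutation w" "planar w"
  shows "w y \<in> gap w x \<longleftrightarrow> y \<in> gap w x"
  by (rule planar_orbit_gap[OF assms orbit.base])

text \<open>Splitting the cycle through \<open>a < b\<close> creates two new gaps. One is the interval from \<open>v a\<close> to
  \<open>b\<close>: every cycle of \<open>v\<close> other than that of \<open>a\<close> lies inside or outside it. The other is obtained from this interval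
  and the gaps of \<open>v\<close> at \<open>a\<close> and \<open>b\<close> by union or difference.\<close>

lemma planar_split_less:
  assumes v: "permutation v" and pl: "planar v" and ab: "a < b" "b \<in> orbit v a"
  shows "planar (v \<circ> transpose a b)"
proof -
  define u where "u = v \<circ> transpose a b"
  have ua: "u a = v b" and ub: "u b = v a" and uo: "\<And>y. y \<noteq> a \<Longrightarrow> y \<noteq> b \<Longrightarrow> u y = v y"
    by (auto simp: u_def)
  have u: "permutation u" unfolding u_def by (intro permutation_compose v permutation_swap_id)
  have asc: "x < v y \<and> v y < v x \<longleftrightarrow> x < y \<and> y < v x" if "x < v x" for x y
    using planar_gap_iff[OF v pl, of y x] that by (simp add: gap_def)
  have desc: "v x \<le> v y \<and> v y \<le> x \<longleftrightarrow> v x \<le> y \<and> y \<le> x" if "v x \<le> x" for x y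
    using planar_gap_iff[OF v pl, of y x] that by (simp add: gap_def)
  have same: "b \<in> gap v x \<longleftrightarrow> a \<in> gap v x" for x
    using planar_orbit_gap[OF v pl ab(2)] .
  have asc': "x < b \<and> b < v x \<longleftrightarrow> x < a \<and> a < v x" if "x < v x" for x
    using same[of x] that by (simp add: gap_def)
  have desc': "v x \<le> b \<and> b \<le> x \<longleftrightarrow> v x \<le> a \<and> a \<le> x" if "v x \<le> x" for x
    using same[of x] that by (simp add: gap_def)
  have va: "a < v a" "v a \<le> b"
  proof -
    show "a < v a" using desc'[of a] ab(1) by linarith
    then show "v a \<le> b" using asc'[of a] ab(1) by linarith
  qed
  have inv: "u ` S \<subseteq> S" if S: "v ` S \<subseteq> S" for S
  proof clarify
    fix y assume "y \<in> S"
    then have "orbit v y \<subseteq> S" using S by (rule orbit_subset_invariant)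
    moreover have "u y \<in> orbit u y" by (rule orbit.base)
    ultimately show "u y \<in> S"
      using orbit_split(4)[OF v _ ab(2), of y] ab(1) unfolding u_def by blast
  qed
  have gv: "u ` gap v x \<subseteq> gap v x" for x using inv pl by (simp add: planar_def)
  have mid: "u ` {v a..b} \<subseteq> {v a..b}"
  proof
    fix z assume "z \<in> u ` {v a..b}"
    then obtain y where y: "z = u y" "v a \<le> y" "y \<le> b" by auto
    show "z \<in> {v a..b}"
    proof (cases "y = b")
      case True
      then show ?thesis using y(1) ub va by simp
    next
      case False
      then have yb: "y < b" and ya: "a < y" using y va by auto
      have uy: "u y = v y" using uo ya yb by auto
      have "v y \<le> b"
        using asc'[of y] yb ya by linarith
      moreover have "v a \<le> v y"
      proof (rule ccontr)
        assume c: "\<not> v a \<le> v y"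
        then have "v y < y" using y(2) by linarith
        have "v y \<le> a" using asc[OF va(1), of y] c y(2) by linarith
        then show False using desc'[of y] \<open>v y < y\<close> ya yb by linarith
      qed
      ultimately show ?thesis using y(1) uy by simp
    qed
  qed
  have ga: "gap v a = {a<..<v a}" using va by (simp add: gap_def)
  have "u ` gap u x \<subseteq> gap u x" for x
  proof -
    consider "x = a" "b < v b" | "x = a" "v b \<le> b" | "x = b" | "x \<noteq> a" "x \<noteq> b" by fastforce
    then show ?thesis
    proof cases
      case 1
      have "gap u x = gap v a \<union> {v a..b} \<union> gap v b"
        using 1 va ab(1) ua ga by (auto simp: gap_def)
      then show ?thesis using gv[of a] gv[of b] mid by blast
    next
      case 2
      have vb: "v b \<le> a" using desc'[of b] 2 ab(1) by linarith
      have "gap u x = gap v b - gap v a - {v a..b}"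
        using 2 va ab(1) ua ga vb by (auto simp: gap_def)
      moreover have "u y \<in> gap v b - gap v a - {v a..b}" if "y \<in> gap v b - gap v a - {v a..b}" for y
        using invariant_mem_iff[OF u gv, of y] invariant_mem_iff[OF u mid, of y] that by blast
      ultimately show ?thesis by auto
    next
      case 3
      then show ?thesis using mid ub va by (simp add: gap_def)
    next
      case 4
      then have "u x = v x" by (rule uo)
      then have "gap u x = gap v x" by (simp only: gap_def)
      then show ?thesis using gv[of x] by simp
    qed
  qed
  then show ?thesis unfolding planar_def u_def by blast
qed

lemma planar_split:
  assumes v: "permutation v" and pl: "planar v" and ab: "a \<noteq> b" "b \<in> orbit v a"
  shows "planar (v \<circ> transpose a b)"
proof (cases "a < b")
  case True
  then show ?thesis using planar_split_less[OF v pl] ab by blast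
next
  case False
  then have "b < a" "a \<in> orbit v b" using ab mem_orbit_commute[OF v] by auto
  then have "planar (v \<circ> transpose b a)" using planar_split_less[OF v pl] by blast
  then show ?thesis by (simp only: transpose_commute)
qed

lemma abs_le_planar:
  assumes "abs_le n u v" "u permutes {1..n}" "v permutes {1..n}" "planar v"
  shows "planar u"
  using assms(1-3)
proof (induction rule: abs_le_split_induct)
  case refl
  then show ?case using assms(4) .
next
  case (split w a b)
  show ?case by (rule planar_split[OF permutation_of_permutes[OF split(1)] split(6,4,5)])
qed

text \<open>If \<open>u\<close> and \<open>v\<close> differ at \<open>x\<close>, split the cycle of \<open>v\<close> through \<open>x\<close> so that the new permutation
  maps \<open>x\<close> to \<open>u x\<close>. Its gap at \<open>x\<close> is then a gap of \<open>u\<close> as well, and this gap separates the two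
  new cycles; so no cycle of \<open>u\<close> meets both.\<close>

lemma planar_abs_le:
  assumes u: "u permutes {1..n}" "planar u" and v: "v permutes {1..n}" "planar v"
    and ref: "\<And>y. u y \<in> orbit v y"
  shows "abs_le n u v"
  using v ref
proof (induction "card {x. u x \<noteq> v x}" arbitrary: v rule: less_induct)
  case less
  note v = less.prems(1) and plv = less.prems(2) and ref = less.prems(3)
  have pv: "permutation v" and pu: "permutation u" using u(1) v by auto
  show ?case
  proof (cases "u = v")
    case True
    then show ?thesis using u(1) abs_le_refl by simp
  next
    case False
    then obtain x where x: "u x \<noteq> v x" by (auto simp: fun_eq_iff)
    have xn: "x \<in> {1..n}"
      using x permutes_not_in[OF u(1), of x] permutes_not_in[OF v, of x] by metis
    \<comment> \<open>the point whose transposition with \<open>x\<close> redirects \<open>x\<close> to \<open>u x\<close>\<close>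
    define b where "b = inv v (u x)"
    have vb: "v b = u x" by (simp add: b_def permutes_inverses[OF v])
    have bx: "b \<noteq> x" using vb x by auto
    have b: "b \<in> orbit v x"
      using ref[of x] vb permutation_orbit_step[OF pv, of b] orbit_eq_iff_mem[OF pv]
        mem_orbit_commute[OF pv] by metis
    have bn: "b \<in> {1..n}" using permutes_orbit_subset[OF v xn] b by blast
    define w where "w = v \<circ> transpose x b"
    have w: "w permutes {1..n}" unfolding w_def using permutes_comp_transpose[OF v xn bn] .
    then have pw: "permutation w" by auto
    have wx: "w x = u x" and wb: "w b = v x" and wo: "\<And>y. y \<noteq> x \<Longrightarrow> y \<noteq> b \<Longrightarrow> w y = v y"
      using vb by (auto simp: w_def)
    have plw: "planar w" unfolding w_def using planar_split[OF pv plv bx[symmetric] b] .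
    note s = orbit_split[OF pv bx[symmetric] b, folded w_def]
    have same: "x \<in> gap v z \<longleftrightarrow> b \<in> gap v z" for z
      using planar_orbit_gap[OF pv plv] b mem_orbit_commute[OF pv] by blast
    have gx: "gap w x = gap u x" by (simp add: gap_def wx)
    \<comment> \<open>the gap of \<open>v\<close> at \<open>b\<close> ends at \<open>v b = u x\<close> and has \<open>x\<close> and \<open>b\<close> on the same side\<close>
    have sep: "x \<in> gap u x \<longleftrightarrow> b \<notin> gap u x"
    proof -
      have "x \<in> gap v b \<longleftrightarrow> b \<in> gap v b" by (rule same)
      then show ?thesis using bx unfolding gap_def vb by (auto split: if_splits)
    qed
    have ref': "u y \<in> orbit w y" for y
    proof (cases "y \<in> orbit v x")
      case False
      then show ?thesis using s(3) ref by simp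
    next
      case True
      then have "u y \<in> orbit v x" using ref[of y] orbit_trans by metis
      then have uy: "u y \<in> orbit w x \<union> orbit w b" and y: "y \<in> orbit w x \<union> orbit w b"
        using True s(1) by auto
      have g: "z \<in> orbit w x \<longleftrightarrow> (z \<in> gap u x \<longleftrightarrow> x \<in> gap u x)"
        if "z \<in> orbit w x \<union> orbit w b" for z
        using planar_orbit_gap[OF pw plw, of z x x] planar_orbit_gap[OF pw plw, of z b x]
          that sep s(2) unfolding gx by blast
      have "u y \<in> gap u x \<longleftrightarrow> y \<in> gap u x" using planar_gap_iff[OF pu u(2)] .
      then have "u y \<in> orbit w x \<longleftrightarrow> y \<in> orbit w x" using g[OF uy] g[OF y] by blast
      then have "u y \<in> orbit w x \<and> y \<in> orbit w x \<or> u y \<in> orbit w b \<and> y \<in> orbit w b"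
        using uy y by blast
      then show ?thesis using orbit_eq_iff_mem[OF pw] by metis
    qed
    have "{z. u z \<noteq> w z} \<subset> {z. u z \<noteq> v z}"
    proof
      show "{z. u z \<noteq> w z} \<subseteq> {z. u z \<noteq> v z}"
      proof clarify
        fix z assume z: "u z = v z" "u z \<noteq> w z"
        have "u b \<noteq> u x" using bx permutes_inj[OF u(1)] by (simp add: inj_eq)
        then show False using z wx wo[of z] vb by metis
      qed
      have "x \<in> {z. u z \<noteq> v z}" "x \<notin> {z. u z \<noteq> w z}" using x wx by simp_all
      then show "{z. u z \<noteq> w z} \<noteq> {z. u z \<noteq> v z}" by metis
    qed
    moreover have "finite {z. u z \<noteq> v z}"
      by (rule finite_subset[of _ "{1..n}"])
        (use permutes_not_in[OF u(1)] permutes_not_in[OF v] in force, simp)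
    ultimately have "abs_le n u w" using less.hyps w plw ref' psubset_card_mono by blast
    then show ?thesis
      unfolding w_def using abs_le_split_trans u(1) v xn bn bx b by blast
  qed
qed

lemma coxeter_permutes: "coxeter n permutes {1..n}"
  using cycle_permutes[of "[1..<Suc n]"] by (simp add: coxeter_def atLeastLessThanSuc_atLeastAtMost del: upt_Suc)

lemma coxeter_apply:
  assumes "x \<in> {1..n}"
  shows "coxeter n x = (if x < n then Suc x else 1)"
proof -
  let ?cs = "[1..<Suc n]"
  have "map (coxeter n) ?cs = rotate 1 ?cs"
    using cyclic_rotation[of ?cs 1] by (simp add: coxeter_def del: upt_Suc)
  then have "map (coxeter n) ?cs ! (x - 1) = rotate1 ?cs ! (x - 1)" by simp
  moreover have "map (coxeter n) ?cs ! (x - 1) = coxeter n x"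
    using assms by (subst nth_map) (auto simp del: upt_Suc)
  moreover have "rotate1 ?cs ! (x - 1) = (if x < n then Suc x else 1)"
    using assms nth_rotate1[of "x - 1" ?cs] by (auto simp del: upt_Suc)
  ultimately show ?thesis by simp
qed

lemma planar_coxeter: "planar (coxeter n)"
  unfolding planar_def
proof
  fix x
  show "coxeter n ` gap (coxeter n) x \<subseteq> gap (coxeter n) x"
  proof (cases "x \<in> {1..n}")
    case True
    then consider "gap (coxeter n) x = {}" | "gap (coxeter n) x = {1..n}"
      by (cases "x < n") (force simp: gap_def coxeter_apply)+
    then show ?thesis
      by cases (use permutes_image[OF coxeter_permutes, of n] in simp_all)
  next
    case False
    then show ?thesis using permutes_not_in[OF coxeter_permutes] by (simp add: gap_def)
  qed
qed

lemma orbit_coxeter: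
  assumes "x \<in> {1..n}"
  shows "orbit (coxeter n) x = {1..n}"
proof -
  have p: "permutation (coxeter n)" by (rule permutation_of_permutes[OF coxeter_permutes])
  have "y \<in> orbit (coxeter n) 1" if "1 \<le> y" "y \<le> n" for y
    using that
  proof (induction y rule: dec_induct)
    case base
    show ?case by (rule permutation_self_in_orbit[OF p])
  next
    case (step m)
    then have "coxeter n m \<in> orbit (coxeter n) 1" by (intro orbit.step) simp
    then show ?case using step by (simp add: coxeter_apply)
  qed
  then have "{1..n} \<subseteq> orbit (coxeter n) 1" by auto
  moreover have "orbit (coxeter n) 1 \<subseteq> {1..n}"
    using assms by (intro permutes_orbit_subset coxeter_permutes) auto
  ultimately show ?thesis using assms orbit_eq_iff_mem[OF p] by blast
qed

lemma orbit_partition_coxeter: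
  assumes "1 \<le> n"
  shows "orbit_partition n (coxeter n) = {{1..n}}"
proof -
  have "orbit_partition n (coxeter n) = (\<lambda>_. {1..n}) ` {1..n}"
    unfolding orbit_partition_def by (rule image_cong[OF refl orbit_coxeter])
  also have "\<dots> = {{1..n}}" using assms by auto
  finally show ?thesis .
qed

lemma word_length_coxeter:
  assumes "1 \<le> n"
  shows "Suc (word_length n (coxeter n)) = n"
  using word_length_plus_cycles[OF coxeter_permutes, of n] orbit_partition_coxeter[OF assms]
  by (simp add: cycles_def)

lemma NC_perm_iff: "w \<in> NC_perm n \<longleftrightarrow> w permutes {1..n} \<and> planar w"
proof
  assume "w \<in> NC_perm n"
  then show "w permutes {1..n} \<and> planar w"
    using abs_le_planar[OF _ _ coxeter_permutes planar_coxeter] by (auto simp: NC_perm_def)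
next
  assume w: "w permutes {1..n} \<and> planar w"
  have "w y \<in> orbit (coxeter n) y" for y
  proof (cases "y \<in> {1..n}")
    case True
    then show ?thesis using w permutes_in_image orbit_coxeter by metis
  next
    case False
    then have "w y = coxeter n y" using w permutes_not_in coxeter_permutes by metis
    then show ?thesis using orbit.base by metis
  qed
  then show "w \<in> NC_perm n"
    using w planar_abs_le[OF _ _ coxeter_permutes planar_coxeter]
    by (auto simp: NC_perm_def id_abs_le)
qed

lemma NC_perm_permutes: "w \<in> NC_perm n \<Longrightarrow> w permutes {1..n}"
  by (simp add: NC_perm_def)

lemma coxeter_in_NC_perm: "coxeter n \<in> NC_perm n"
  using coxeter_permutes planar_coxeter by (simp add: NC_perm_iff)


section \<open>Noncrossing permutations and noncrossing partitions\<close>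

text \<open>A cycle that meets the interval \<open>{b<..<d}\<close> without staying inside enters it at some step from
  \<open>y\<close> to \<open>w y\<close>; the gap at \<open>y\<close> then contains exactly one of \<open>b\<close> and \<open>d\<close>, although
  these lie on one cycle.\<close>

lemma noncrossing_orbit_partition:
  assumes w: "permutation w" and pl: "planar w"
  shows "noncrossing (orbit_partition n w)"
  unfolding noncrossing_def
proof (intro notI, elim exE bexE conjE)
  fix a b c d B B'
  assume B: "B \<in> orbit_partition n w" "B' \<in> orbit_partition n w" "B \<noteq> B'"
    and lt: "a < b" "b < c" "c < d" and m: "a \<in> B" "c \<in> B" "b \<in> B'" "d \<in> B'"
  have Beq: "B = orbit w a" "B' = orbit w b"
    using B m orbit_eq_iff_mem[OF w] unfolding orbit_partition_def by auto
  have disj: "b \<notin> orbit w a" "d \<notin> orbit w a"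
    using Beq B(3) m(4) orbit_eq_iff_mem[OF w] by metis+
  have "\<exists>y\<in>orbit w a. y \<notin> {b<..<d} \<and> w y \<in> {b<..<d}"
  proof (rule ccontr)
    assume "\<not> ?thesis"
    then have "w ` (orbit w a - {b<..<d}) \<subseteq> orbit w a - {b<..<d}"
      by (auto intro: orbit.step)
    moreover have "a \<in> orbit w a - {b<..<d}"
      using permutation_self_in_orbit[OF w] lt by auto
    ultimately have "orbit w a \<subseteq> orbit w a - {b<..<d}" by (intro orbit_subset_invariant)
    then show False using m(2) lt Beq(1) by auto
  qed
  then obtain y where y: "y \<in> orbit w a" "y \<notin> {b<..<d}" "w y \<in> {b<..<d}" by blast
  have "y \<noteq> b" "y \<noteq> d" using y(1) disj by auto
  moreover have "d \<in> gap w y \<longleftrightarrow> b \<in> gap w y"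
    using planar_orbit_gap[OF w pl] m(4) Beq(2) by blast
  ultimately show False using y(2,3) by (auto simp: gap_def split: if_splits)
qed

definition next_in :: "nat set \<Rightarrow> nat \<Rightarrow> nat" where
  "next_in B x = (if \<exists>y\<in>B. x < y then LEAST y. y \<in> B \<and> x < y else Min B)"

lemma next_in_cases:
  assumes "finite B" "x \<in> B"
  obtains "x < next_in B x" "next_in B x \<in> B" "\<And>y. y \<in> B \<Longrightarrow> x < y \<Longrightarrow> next_in B x \<le> y"
  | "next_in B x = Min B" "next_in B x \<in> B" "\<And>y. y \<in> B \<Longrightarrow> next_in B x \<le> y"
    "\<And>y. y \<in> B \<Longrightarrow> y \<le> x"
proof (cases "\<exists>y\<in>B. x < y")
  case True
  then have "\<exists>y. y \<in> B \<and> x < y" by blast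
  from LeastI_ex[OF this] have "next_in B x \<in> B \<and> x < next_in B x" using True by (simp add: next_in_def)
  moreover have "next_in B x \<le> y" if "y \<in> B" "x < y" for y
    using that True unfolding next_in_def by (auto intro: Least_le)
  ultimately show ?thesis using that(1) by blast
next
  case False
  then have e: "next_in B x = Min B" unfolding next_in_def by simp
  moreover have "Min B \<in> B" using assms by (intro Min_in) auto
  moreover have "Min B \<le> y" if "y \<in> B" for y using assms that by auto
  ultimately show ?thesis using that(2) False by force
qed

lemma next_in_inj:
  assumes "finite B"
  shows "inj_on (next_in B) B"
proof (rule linorder_inj_onI)
  fix x y assume xy: "x < y" "x \<in> B" "y \<in> B"
  have "next_in B x \<le> y" "x < next_in B x"
    by (rule next_in_cases[OF assms xy(2)]; use xy in force)+
  moreover have "y < next_in B y \<or> next_in B y \<le> x"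
    by (rule next_in_cases[OF assms xy(3)]) (use xy in auto)
  ultimately show "next_in B x \<noteq> next_in B y" by auto
qed auto

text \<open>Sending every point to the cyclically next point of its block realises a given noncrossing
  partition: the largest point of an orbit is sent to the minimum of its block, so
  there is only one orbit per block.\<close>

lemma exists_planar_perm:
  assumes P: "P \<in> NC n"
  obtains w where "w \<in> NC_perm n" "orbit_partition n w = P"
proof -
  have part: "partition_on {1..n} P" and nc: "noncrossing P" using P by (auto simp: NC_def)
  have U: "\<Union>P = {1..n}" and disj: "\<And>A B x. A \<in> P \<Longrightarrow> B \<in> P \<Longrightarrow> x \<in> A \<Longrightarrow> x \<in> B \<Longrightarrow> A = B"
    and ne: "{} \<notin> P"
    using part unfolding partition_on_def disjoint_def by blast+
  define blk where "blk x = (THE B. B \<in> P \<and> x \<in> B)" for x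
  have blkI: "blk x = B" if "B \<in> P" "x \<in> B" for x B
    unfolding blk_def
  proof (rule the_equality)
    show "A = B" if "A \<in> P \<and> x \<in> A" for A
      by (rule disj[of A B x]) (use that \<open>B \<in> P\<close> \<open>x \<in> B\<close> in simp_all)
  qed (use that in simp)
  have blk: "blk x \<in> P" "x \<in> blk x" if xn: "x \<in> {1..n}" for x
  proof -
    obtain B where B: "B \<in> P" "x \<in> B" using U xn by blast
    then show "blk x \<in> P" "x \<in> blk x" using blkI[OF B] by simp_all
  qed
  have fin: "finite B" if "B \<in> P" for B
    using U that by (metis Sup_upper finite_atLeastAtMost finite_subset)
  have sub: "B \<subseteq> {1..n}" if "B \<in> P" for B using U that by blast
  define w where "w x = (if x \<in> {1..n} then next_in (blk x) x else x)" for x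
  have wB: "w x = next_in B x" if "B \<in> P" "x \<in> B" for x B
  proof -
    have "x \<in> {1..n}" using sub[OF that(1)] that(2) by blast
    then show ?thesis unfolding w_def blkI[OF that] by simp
  qed
  have closed: "w x \<in> B" if "B \<in> P" "x \<in> B" for x B
    using next_in_cases[OF fin[OF that(1)] that(2)] wB[OF that] by metis
  have w: "w permutes {1..n}"
  proof (rule inj_imp_permutes)
    show "inj_on w {1..n}"
    proof (rule inj_onI)
      fix x y assume xy: "x \<in> {1..n}" "y \<in> {1..n}" "w x = w y"
      have "blk x = blk y"
        using closed[OF blk[OF xy(1)]] closed[OF blk[OF xy(2)]] xy(3) blk xy(1,2) disj by metis
      then show "x = y"
        using next_in_inj[OF fin[OF blk(1)[OF xy(1)]]] blk xy unfolding w_def inj_on_def by metis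
    qed
    show "w x \<in> {1..n}" if "x \<in> {1..n}" for x
      using closed[OF blk[OF that]] sub[OF blk(1)[OF that]] by blast
  qed (auto simp: w_def)
  then have pw: "permutation w" by auto
  have orb: "orbit w x = B" if B: "B \<in> P" "x \<in> B" for x B
  proof -
    have sb: "orbit w y \<subseteq> B" if "y \<in> B" for y
      using that closed[OF B(1)] by (intro orbit_subset_invariant) auto
    have "Min B \<in> orbit w y" if y: "y \<in> B" for y
    proof -
      have f: "finite (orbit w y)" using finite_orbit_permutation[OF pw] .
      define M where "M = Max (orbit w y)"
      have M: "M \<in> orbit w y" unfolding M_def using f orbit_nonempty by (intro Max_in)
      then have wM: "w M \<in> orbit w y" by (rule orbit.step)
      then have "w M \<le> M" unfolding M_def using f by (intro Max_ge)
      moreover have MB: "M \<in> B" using M sb[OF y] by blast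
      ultimately have "w M = Min B"
        using next_in_cases[OF fin[OF B(1)] MB] wB[OF B(1) MB] by (metis leD)
      then show ?thesis using wM by simp
    qed
    then have "orbit w y = orbit w (Min B)" if "y \<in> B" for y
      using orbit_eq_iff_mem[OF pw] that by metis
    then show ?thesis using sb[OF B(2)] B(2) orbit_eq_iff_mem[OF pw] by blast
  qed
  have op: "orbit_partition n w = P"
  proof (intro equalityI subsetI)
    fix B assume "B \<in> orbit_partition n w"
    then obtain x where x: "x \<in> {1..n}" "B = orbit w x" by (auto simp: orbit_partition_def)
    then show "B \<in> P" using orb[OF blk[OF x(1)]] blk(1)[OF x(1)] by simp
  next
    fix B assume B: "B \<in> P"
    then obtain x where "x \<in> B" using ne by fastforce
    then have "x \<in> {1..n}" "orbit w x = B" using orb[OF B] sub[OF B] by blast+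
    then show "B \<in> orbit_partition n w" using orbit_partition_mem by metis
  qed
  have cross: False if "A \<in> P" "B \<in> P" "A \<noteq> B" "p < q" "q < r" "r < s" "p \<in> A" "r \<in> A" "q \<in> B" "s \<in> B"
    for A B p q r s
    using nc that unfolding noncrossing_def by blast
  have "planar w"
    unfolding planar_def
  proof (intro allI subsetI)
    fix x z assume "z \<in> w ` gap w x"
    then obtain y where y: "y \<in> gap w x" and z: "z = w y" by blast
    show "z \<in> gap w x"
    proof (cases "x \<in> {1..n}")
      case False
      then have "w x = x" unfolding w_def by (rule if_not_P)
      moreover from this have "gap w x = {x}" by (simp add: gap_def)
      ultimately show ?thesis using y z by simp
    next
      case True
      note B = blk[OF True] and wx = closed[OF blk[OF True]]
      have "w x \<in> {1..n}" using wx sub[OF B(1)] by blast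
      then have yn: "y \<in> {1..n}" using y True by (auto simp: gap_def split: if_splits)
      note B' = blk[OF yn] and wy = closed[OF blk[OF yn]]
      note eq = wB[OF B]
      show ?thesis
      proof (rule next_in_cases[OF fin[OF B(1)] B(2), folded eq])
        assume up: "x < w x" and least: "\<And>y. y \<in> blk x \<Longrightarrow> x < y \<Longrightarrow> w x \<le> y"
        have g: "gap w x = {x<..<w x}" using up by (simp add: gap_def)
        have "y \<notin> blk x" using least[of y] y g by auto
        then have ne: "blk y \<noteq> blk x" using B' by auto
        then have "w y \<noteq> x" "w y \<noteq> w x" using wy wx B B' disj by metis+
        moreover have "\<not> w y < x" using cross[OF B'(1) B(1) ne, of "w y" x y "w x"] wy B' B wx y g by auto
        moreover have "\<not> w x < w y" using cross[OF B(1) B'(1) ne[symmetric], of x y "w x" "w y"] wy B' B wx y g by auto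
        ultimately show ?thesis using z g by auto
      next
        assume lo: "\<And>y. y \<in> blk x \<Longrightarrow> w x \<le> y" and hi: "\<And>y. y \<in> blk x \<Longrightarrow> y \<le> x"
        have g: "gap w x = {w x..x}" using lo[OF B(2)] by (simp add: gap_def)
        show ?thesis
        proof (cases "blk y = blk x")
          case True
          then show ?thesis using wy lo hi g z by auto
        next
          case ne: False
          then have "y \<noteq> x" "y \<noteq> w x" using wx B B' disj by metis+
          then have "\<not> w y < w x" "\<not> x < w y"
            using cross[OF B'(1) B(1) ne, of "w y" "w x" y x]
              cross[OF B(1) B'(1) ne[symmetric], of "w x" y x "w y"] wy B' B wx y g by auto
          then show ?thesis using z g by auto
        qed
      qed
    qed
  qed
  then show ?thesis using that w op by (simp add: NC_perm_iff)
qed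

lemma orbit_partition_in_NC: "w \<in> NC_perm n \<Longrightarrow> orbit_partition n w \<in> NC n"
  unfolding NC_perm_iff NC_def
  using partition_on_orbit_partition noncrossing_orbit_partition permutation_of_permutes by blast

lemma refines_orbit_partition_iff:
  assumes u: "u permutes {1..n}" and v: "v permutes {1..n}"
  shows "refines {1..n} (orbit_partition n u) (orbit_partition n v) \<longleftrightarrow> (\<forall>x. orbit u x \<subseteq> orbit v x)"
proof
  have pv: "permutation v" and pu: "permutation u" using u v by auto
  assume r: "refines {1..n} (orbit_partition n u) (orbit_partition n v)"
  show "\<forall>x. orbit u x \<subseteq> orbit v x"
  proof
    fix x show "orbit u x \<subseteq> orbit v x"
    proof (cases "x \<in> {1..n}")
      case True
      then obtain B where B: "B \<in> orbit_partition n v" "orbit u x \<subseteq> B"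
        using r orbit_partition_mem[OF True, of u] unfolding refines_def by blast
      moreover have "x \<in> B" using B(2) permutation_self_in_orbit[OF pu] by blast
      ultimately show ?thesis using orbit_eq_iff_mem[OF pv] by (auto simp: orbit_partition_def)
    next
      case False
      then have "orbit u x = {x}" "orbit v x = {x}"
        using permutes_not_in[OF u] permutes_not_in[OF v] by (simp_all add: orbit_eq_singleton_iff)
      then show ?thesis by simp
    qed
  qed
next
  assume "\<forall>x. orbit u x \<subseteq> orbit v x"
  then show "refines {1..n} (orbit_partition n u) (orbit_partition n v)"
    using partition_on_orbit_partition[OF u] partition_on_orbit_partition[OF v]
    unfolding refines_def by (auto simp: orbit_partition_def)
qed

lemma abs_le_iff_refines:
  assumes u: "u \<in> NC_perm n" and v: "v \<in> NC_perm n"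
  shows "abs_le n u v \<longleftrightarrow> refines {1..n} (orbit_partition n u) (orbit_partition n v)"
proof -
  have p: "u permutes {1..n}" "v permutes {1..n}" "planar u" "planar v"
    using u v by (auto simp: NC_perm_iff)
  have "abs_le n u v" if "\<forall>x. orbit u x \<subseteq> orbit v x"
    using planar_abs_le[OF p(1,3,2,4)] that orbit.base by fast
  then show ?thesis
    unfolding refines_orbit_partition_iff[OF p(1,2)] using abs_le_orbit_subset[OF _ p(1,2)] by blast
qed

lemma orbit_partition_inj: "inj_on (orbit_partition n) (NC_perm n)"
proof (rule inj_onI)
  fix u v assume uv: "u \<in> NC_perm n" "v \<in> NC_perm n" "orbit_partition n u = orbit_partition n v"
  have "refines {1..n} (orbit_partition n u) (orbit_partition n u)"
    using uv by (intro refines_refl partition_on_orbit_partition NC_perm_permutes)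
  then have "abs_le n u v" "abs_le n v u" using uv by (simp_all add: abs_le_iff_refines)
  then show "u = v" using abs_le_antisym uv NC_perm_permutes by blast
qed


(* keeps the intervals {1..n} in the form in which the lemmas state them *)
declare One_nat_def [simp del]

lemma planar_eq_next_in:
  assumes w: "permutation w" and pl: "planar w"
  shows "w x = next_in (orbit w x) x"
proof -
  let ?B = "orbit w x"
  have x: "x \<in> ?B" and wx: "w x \<in> ?B" and f: "finite ?B"
    using w by (auto intro: permutation_self_in_orbit orbit.base finite_orbit_permutation)
  have g: "y \<in> gap w x \<longleftrightarrow> x \<in> gap w x" if "y \<in> ?B" for y
    using planar_orbit_gap[OF w pl that] .
  show ?thesis
  proof (rule next_in_cases[OF f x])
    assume a: "x < next_in ?B x" "next_in ?B x \<in> ?B" "\<And>y. y \<in> ?B \<Longrightarrow> x < y \<Longrightarrow> next_in ?B x \<le> y"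
    show ?thesis
    proof (cases "x < w x")
      case True
      then have "\<not> next_in ?B x < w x" using g[OF a(2)] a(1) by (simp add: gap_def)
      then show ?thesis using a(3)[OF wx True] by simp
    next
      case False
      then show ?thesis using g[OF a(2)] a(1) by (simp add: gap_def)
    qed
  next
    assume a: "next_in ?B x \<in> ?B" "\<And>y. y \<in> ?B \<Longrightarrow> next_in ?B x \<le> y" "\<And>y. y \<in> ?B \<Longrightarrow> y \<le> x"
    have "w x \<le> x" using a(3)[OF wx] .
    then have "w x \<le> next_in ?B x" using g[OF a(1)] by (simp add: gap_def)
    then show ?thesis using a(2)[OF wx] by simp
  qed
qed

lemma next_in_eqI:
  assumes "finite B" "y \<in> B"
    and "(x < y \<and> (\<forall>z\<in>B. x < z \<longrightarrow> y \<le> z)) \<or> ((\<forall>z\<in>B. z \<le> x) \<and> (\<forall>z\<in>B. y \<le> z))"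
  shows "next_in B x = y"
  using assms(3)
proof
  assume a: "x < y \<and> (\<forall>z\<in>B. x < z \<longrightarrow> y \<le> z)"
  then have "next_in B x = (LEAST z. z \<in> B \<and> x < z)" using assms(2) by (auto simp: next_in_def)
  also have "\<dots> = y" using a assms(2) by (intro Least_equality) auto
  finally show ?thesis .
next
  assume a: "(\<forall>z\<in>B. z \<le> x) \<and> (\<forall>z\<in>B. y \<le> z)"
  then have "next_in B x = Min B" by (auto simp: next_in_def)
  also have "\<dots> = y" using a assms(1,2) by (intro Min_eqI) auto
  finally show ?thesis .
qed

lemma next_in_image:
  assumes f: "strict_mono_on A f" and B: "B \<subseteq> A" "finite B" "x \<in> B"
  shows "next_in (f ` B) (f x) = f (next_in B x)"
proof (rule next_in_eqI)
  have lt: "f y < f z \<longleftrightarrow> y < z" "f y \<le> f z \<longleftrightarrow> y \<le> z" if "y \<in> B" "z \<in> B" for y z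
    using strict_mono_on_less[OF f] strict_mono_on_less_eq[OF f] that B(1) by blast+
  show "f (next_in B x) \<in> f ` B" by (rule next_in_cases[OF B(2,3)]) auto
  show "f x < f (next_in B x) \<and> (\<forall>z\<in>f ` B. f x < z \<longrightarrow> f (next_in B x) \<le> z) \<or>
    (\<forall>z\<in>f ` B. z \<le> f x) \<and> (\<forall>z\<in>f ` B. f (next_in B x) \<le> z)"
    by (rule next_in_cases[OF B(2,3)]) (use lt B(3) in auto)
qed (use B in simp)

text \<open>A permutation is determined by its orbits once it is known to move cyclically upwards on each of
  them; so noncrossing orbits then force it to be the planar permutation with these orbits.\<close>

lemma NC_perm_iff_next_in:
  assumes w: "w permutes {1..n}"
  shows "w \<in> NC_perm n \<longleftrightarrow> noncrossing (orbit_partition n w) \<and> (\<forall>x\<in>{1..n}. w x = next_in (orbit w x) x)"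
proof
  assume "w \<in> NC_perm n"
  then show "noncrossing (orbit_partition n w) \<and> (\<forall>x\<in>{1..n}. w x = next_in (orbit w x) x)"
    using planar_eq_next_in noncrossing_orbit_partition permutation_of_permutes[OF w]
    by (simp add: NC_perm_iff)
next
  assume a: "noncrossing (orbit_partition n w) \<and> (\<forall>x\<in>{1..n}. w x = next_in (orbit w x) x)"
  then have "orbit_partition n w \<in> NC n"
    using partition_on_orbit_partition[OF w] by (simp add: NC_def)
  then obtain v where v: "v \<in> NC_perm n" "orbit_partition n v = orbit_partition n w"
    using exists_planar_perm by blast
  have v': "v permutes {1..n}" "planar v" using v(1) by (simp_all add: NC_perm_iff)
  have pv: "permutation v" and pw: "permutation w"
    using permutation_of_permutes v'(1) w by blast+
  have "v x = w x" for x
  proof (cases "x \<in> {1..n}")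
    case True
    then have "orbit v x \<in> orbit_partition n w" using v(2) orbit_partition_mem by blast
    then have "orbit v x = orbit w x"
      using permutation_self_in_orbit[OF pv, of x] orbit_eq_iff_mem[OF pw]
      by (auto simp: orbit_partition_def)
    then show ?thesis using planar_eq_next_in[OF pv v'(2)] a True by simp
  next
    case False
    then show ?thesis using permutes_not_in v'(1) w by metis
  qed
  then show "w \<in> NC_perm n" using v(1) by (metis ext)
qed


section \<open>Shuffles of permutations\<close>

text \<open>For \<open>x \<ge> 1\<close> this is \<open>k x - (k - (i + 1))\<close>, the dilation and translation applied to the \<open>(i + 1)\<close>-st
  argument of a shuffle, written without a subtraction that involves \<open>i\<close>.\<close>

definition slot :: "nat \<Rightarrow> nat \<Rightarrow> nat \<Rightarrow> nat" where
  "slot k i x = k * (x - 1) + Suc i"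

definition slot_class :: "nat \<Rightarrow> nat \<Rightarrow> nat" where
  "slot_class k p = (p - 1) mod k"

definition slot_pos :: "nat \<Rightarrow> nat \<Rightarrow> nat" where
  "slot_pos k p = Suc ((p - 1) div k)"

lemma slot_class_slot [simp]: "i < k \<Longrightarrow> slot_class k (slot k i x) = i"
  by (simp add: slot_class_def slot_def)

lemma slot_pos_slot [simp]: "i < k \<Longrightarrow> 1 \<le> x \<Longrightarrow> slot_pos k (slot k i x) = x"
  by (simp add: slot_pos_def slot_def)

lemma slot_decompose: "1 \<le> p \<Longrightarrow> slot k (slot_class k p) (slot_pos k p) = p"
  by (simp add: slot_def slot_class_def slot_pos_def)

lemma slot_class_less [simp]: "0 < k \<Longrightarrow> slot_class k p < k"
  by (simp add: slot_class_def)

lemma slot_pos_ge [simp]: "1 \<le> slot_pos k p"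
  by (simp add: slot_pos_def)

lemma slot_le_iff:
  assumes "i < k" "1 \<le> x"
  shows "slot k i x \<le> k * n \<longleftrightarrow> x \<le> n"
proof
  assume "x \<le> n"
  then obtain y where y: "x = Suc y" "Suc y \<le> n" using assms(2) by (cases x) auto
  have "slot k i x \<le> k * Suc y" using assms(1) y(1) by (simp add: slot_def)
  also have "\<dots> \<le> k * n" using y(2) by (rule mult_le_mono2)
  finally show "slot k i x \<le> k * n" .
next
  assume a: "slot k i x \<le> k * n"
  show "x \<le> n"
  proof (rule ccontr)
    assume "\<not> x \<le> n"
    then have "n \<le> x - 1" by simp
    then have "k * n \<le> k * (x - 1)" by (rule mult_le_mono2)
    then show False using a unfolding slot_def by linarith
  qed
qed

lemma slot_mem_iff:
  assumes "i < k" "1 \<le> x"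
  shows "slot k i x \<in> {1..k * n} \<longleftrightarrow> x \<in> {1..n}"
  using slot_le_iff[OF assms] assms by (simp add: slot_def)

lemma slot_pos_mem:
  assumes "0 < k" "p \<in> {1..k * n}"
  shows "slot_pos k p \<in> {1..n}"
  using slot_mem_iff[of "slot_class k p" k "slot_pos k p" n] slot_decompose[of p k] assms by simp

lemma slotE:
  assumes "0 < k" "p \<in> {1..k * n}"
  obtains i x where "i < k" "x \<in> {1..n}" "p = slot k i x"
  using that[of "slot_class k p" "slot_pos k p"] slot_pos_mem[OF assms] slot_decompose[of p k] assms
  by auto

lemma slot_strict_mono: "0 < k \<Longrightarrow> strict_mono_on {1..} (slot k i)"
  by (rule strict_mono_onI) (auto simp: slot_def)

lemma slot_eq_iff:
  assumes "i < k" "j < k" "1 \<le> x" "1 \<le> y"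
  shows "slot k i x = slot k j y \<longleftrightarrow> i = j \<and> x = y"
  using assms slot_class_slot slot_pos_slot by metis

definition shuffle_perm :: "nat \<Rightarrow> (nat \<Rightarrow> nat) list \<Rightarrow> nat \<Rightarrow> nat" where
  "shuffle_perm n ds p = (let k = length ds in
     if p \<in> {1..k * n} then slot k (slot_class k p) ((ds ! slot_class k p) (slot_pos k p)) else p)"

locale perm_list =
  fixes n :: nat and ds :: "(nat \<Rightarrow> nat) list"
  assumes n: "1 \<le> n" and ne: "ds \<noteq> []" and perms: "\<And>d. d \<in> set ds \<Longrightarrow> d permutes {1..n}"
begin

abbreviation k where "k \<equiv> length ds"
abbreviation \<sigma> where "\<sigma> \<equiv> shuffle_perm n ds"

lemma k_pos: "0 < k"
  using ne by simp

lemma nth_permutes: "i < k \<Longrightarrow> ds ! i permutes {1..n}"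
  by (rule perms) simp

lemma nth_in: "i < k \<Longrightarrow> x \<in> {1..n} \<Longrightarrow> (ds ! i) x \<in> {1..n}"
  using permutes_in_image[OF nth_permutes] by blast

lemma shuffle_perm_slot:
  assumes "i < k" "x \<in> {1..n}"
  shows "\<sigma> (slot k i x) = slot k i ((ds ! i) x)"
  using assms slot_mem_iff[of i k x n] by (simp add: shuffle_perm_def Let_def)

lemma shuffle_perm_permutes: "\<sigma> permutes {1..k * n}"
proof (rule inj_imp_permutes)
  show "inj_on \<sigma> {1..k * n}"
  proof (rule inj_onI)
    fix p q assume pq: "p \<in> {1..k * n}" "q \<in> {1..k * n}" "\<sigma> p = \<sigma> q"
    obtain i x where p: "i < k" "x \<in> {1..n}" "p = slot k i x" using slotE[OF k_pos pq(1)] .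
    obtain j y where q: "j < k" "y \<in> {1..n}" "q = slot k j y" using slotE[OF k_pos pq(2)] .
    have "slot k i ((ds ! i) x) = slot k j ((ds ! j) y)"
      using pq(3) shuffle_perm_slot p q by simp
    then have "i = j \<and> (ds ! i) x = (ds ! j) y"
      using slot_eq_iff[OF p(1) q(1), of "(ds ! i) x" "(ds ! j) y"] nth_in[OF p(1,2)] nth_in[OF q(1,2)]
      by (metis atLeastAtMost_iff)
    then show "p = q" using p q permutes_inj[OF nth_permutes[OF p(1)]] by (metis injD)
  qed
  show "\<sigma> p \<in> {1..k * n}" if p: "p \<in> {1..k * n}" for p
  proof -
    obtain i x where ix: "i < k" "x \<in> {1..n}" "p = slot k i x" using slotE[OF k_pos p] .
    show ?thesis
      using shuffle_perm_slot[OF ix(1,2)] nth_in[OF ix(1,2)] slot_mem_iff[OF ix(1), of "(ds ! i) x" n] ix(3)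
      by simp
  qed
  show "\<sigma> p = p" if "p \<notin> {1..k * n}" for p
    using that unfolding shuffle_perm_def Let_def by (rule if_not_P)
qed simp

lemma orbit_shuffle_perm:
  assumes "i < k" "x \<in> {1..n}"
  shows "orbit \<sigma> (slot k i x) = slot k i ` orbit (ds ! i) x"
proof (rule orbit_inverse[symmetric])
  show "x \<in> orbit (ds ! i) x"
    by (rule permutation_self_in_orbit[OF permutation_of_permutes[OF nth_permutes[OF assms(1)]]])
  show "\<sigma> (slot k i y) = slot k i ((ds ! i) y)" if "y \<in> orbit (ds ! i) x" for y
    using permutes_orbit_subset[OF nth_permutes[OF assms(1)] assms(2)] that
    by (intro shuffle_perm_slot[OF assms(1)]) blast
qed

lemma orbit_partition_shuffle_perm_UN:
  "orbit_partition (k * n) \<sigma> = (\<Union>i\<in>{..<k}. (\<lambda>B. slot k i ` B) ` orbit_partition n (ds ! i))"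
proof (intro equalityI subsetI)
  fix O' assume "O' \<in> orbit_partition (k * n) \<sigma>"
  then obtain p where p: "p \<in> {1..k * n}" "O' = orbit \<sigma> p" by (auto simp: orbit_partition_def)
  obtain i x where ix: "i < k" "x \<in> {1..n}" "p = slot k i x" using slotE[OF k_pos p(1)] .
  then show "O' \<in> (\<Union>i\<in>{..<k}. (\<lambda>B. slot k i ` B) ` orbit_partition n (ds ! i))"
    using orbit_shuffle_perm[OF ix(1,2)] p(2) orbit_partition_mem[OF ix(2)] by blast
next
  fix O' assume "O' \<in> (\<Union>i\<in>{..<k}. (\<lambda>B. slot k i ` B) ` orbit_partition n (ds ! i))"
  then obtain i x where ix: "i < k" "x \<in> {1..n}" "O' = slot k i ` orbit (ds ! i) x"
    by (auto simp: orbit_partition_def)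
  then have "O' = orbit \<sigma> (slot k i x)" using orbit_shuffle_perm by simp
  moreover have "slot k i x \<in> {1..k * n}" using slot_mem_iff[of i k x n] ix by simp
  ultimately show "O' \<in> orbit_partition (k * n) \<sigma>" using orbit_partition_mem by simp
qed

lemma shuffle_block_image:
  assumes "i < k" "B \<subseteq> {1..n}"
  shows "(\<lambda>x. k * x - (k - Suc i)) ` B = slot k i ` B"
proof (rule image_cong[OF refl])
  fix x assume "x \<in> B"
  then obtain y where "x = Suc y" using assms(2) by (cases x) auto
  then show "k * x - (k - Suc i) = slot k i x" using assms(1) by (simp add: slot_def)
qed

lemma orbit_partition_shuffle_perm:
  "orbit_partition (k * n) \<sigma> = shuffle (map (orbit_partition n) ds)"
proof -
  have "(\<lambda>B. (\<lambda>x. k * x - (k - Suc i)) ` B) ` orbit_partition n (ds ! i)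
      = (\<lambda>B. slot k i ` B) ` orbit_partition n (ds ! i)" if "i < k" for i
  proof (rule image_cong[OF refl])
    fix B assume "B \<in> orbit_partition n (ds ! i)"
    then have "B \<subseteq> {1..n}"
      using partition_onD1[OF partition_on_orbit_partition[OF nth_permutes[OF that]]] by blast
    then show "(\<lambda>x. k * x - (k - Suc i)) ` B = slot k i ` B" by (rule shuffle_block_image[OF that])
  qed
  then have "orbit_partition (k * n) \<sigma>
      = (\<Union>i\<in>{..<k}. (\<lambda>B. (\<lambda>x. k * x - (k - Suc i)) ` B) ` orbit_partition n (ds ! i))"
    unfolding orbit_partition_shuffle_perm_UN by simp
  also have "\<dots> = (\<Union>j\<in>Suc ` {..<k}. (\<lambda>B. (\<lambda>x. k * x - (k - j)) ` B) ` (map (orbit_partition n) ds ! (j - 1)))"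
    by (simp add: image_image)
  also have "Suc ` {..<k} = {1..k}" by (simp add: image_Suc_lessThan)
  finally show ?thesis by (simp add: shuffle_def Let_def)
qed

lemma cycles_shuffle_perm: "cycles (k * n) \<sigma> = (\<Sum>i<k. cycles n (ds ! i))"
proof -
  let ?F = "\<lambda>i. (\<lambda>B. slot k i ` B) ` orbit_partition n (ds ! i)"
  have sub: "B \<subseteq> {1..n}" "B \<noteq> {}" if "i < k" "B \<in> orbit_partition n (ds ! i)" for i B
    using partition_on_orbit_partition[OF nth_permutes[OF that(1)]] that(2)
    unfolding partition_on_def by blast+
  have inj: "inj_on (slot k i) {1..n}" for i
    using strict_mono_on_imp_inj_on[OF slot_strict_mono[OF k_pos]] by (rule inj_on_subset) auto
  have "card (?F i) = cycles n (ds ! i)" if "i < k" for i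
    unfolding cycles_def
  proof (rule card_image, rule inj_onI)
    fix A B assume "A \<in> orbit_partition n (ds ! i)" "B \<in> orbit_partition n (ds ! i)"
      "slot k i ` A = slot k i ` B"
    then show "A = B" using inj_on_image_eq_iff[OF inj] sub[OF that] by blast
  qed
  moreover have "?F i \<inter> ?F j = {}" if ij: "i < k" "j < k" "i \<noteq> j" for i j
  proof (rule ccontr)
    assume "?F i \<inter> ?F j \<noteq> {}"
    then obtain A B where AB: "A \<in> orbit_partition n (ds ! i)" "B \<in> orbit_partition n (ds ! j)"
      "slot k i ` A = slot k j ` B" by blast
    obtain x where "x \<in> A" using sub(2)[OF ij(1) AB(1)] by blast
    then obtain y where "slot k i x = slot k j y" using AB(3) by blast
    then show False using slot_class_slot ij by metis
  qed
  ultimately show ?thesis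
    unfolding cycles_def orbit_partition_shuffle_perm_UN
    by (subst card_UN_disjoint) (auto simp: cycles_def)
qed

lemma word_length_shuffle_perm:
  "word_length (k * n) \<sigma> = (\<Sum>i<k. word_length n (ds ! i))"
proof -
  have "(\<Sum>i<k. word_length n (ds ! i)) + (\<Sum>i<k. cycles n (ds ! i)) = (\<Sum>i<k. n)"
    unfolding sum.distrib[symmetric]
    by (intro sum.cong refl) (simp add: word_length_plus_cycles nth_permutes)
  then show ?thesis
    using word_length_plus_cycles[OF shuffle_perm_permutes] cycles_shuffle_perm by simp
qed

end


text \<open>Every cycle of \<open>f\<close> meets the image of \<open>e\<close>, and it meets it exactly along a cycle of the
  return map \<open>g\<close>.\<close>

lemma cycles_return_map:
  assumes f: "f permutes {1..N}" and g: "g permutes {1..n}"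
    and e: "inj_on e {1..n}" "e ` {1..n} \<subseteq> {1..N}"
    and return: "\<And>x. x \<in> {1..n} \<Longrightarrow> (f ^^ k) (e x) = e (g x)"
    and first: "\<And>j x y. x \<in> {1..n} \<Longrightarrow> y \<in> {1..n} \<Longrightarrow> (f ^^ j) (e x) = e y \<Longrightarrow> k dvd j"
    and meets: "\<And>p. p \<in> {1..N} \<Longrightarrow> \<exists>x\<in>{1..n}. e x \<in> orbit f p"
  shows "cycles N f = cycles n g"
proof -
  have pf: "permutation f" and pg: "permutation g"
    using permutation_of_permutes f g by blast+
  have pow: "(f ^^ (k * m)) (e x) = e ((g ^^ m) x) \<and> (g ^^ m) x \<in> {1..n}" if x: "x \<in> {1..n}" for m x
  proof (induction m)
    case 0
    then show ?case using x by simp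
  next
    case (Suc m)
    have "(f ^^ (k * Suc m)) (e x) = (f ^^ k) ((f ^^ (k * m)) (e x))"
      by (simp add: funpow_add)
    also have "\<dots> = e (g ((g ^^ m) x))" using Suc return by simp
    finally show ?case using Suc permutes_in_image[OF g] by simp
  qed
  have iff: "e y \<in> orbit f (e x) \<longleftrightarrow> y \<in> orbit g x" if xy: "x \<in> {1..n}" "y \<in> {1..n}" for x y
  proof
    assume "e y \<in> orbit f (e x)"
    then obtain j where j: "(f ^^ j) (e x) = e y" unfolding orbit_altdef_permutation[OF pf] by auto
    then obtain m where "j = k * m" using first[OF xy j] by blast
    then have "e ((g ^^ m) x) = e y" "(g ^^ m) x \<in> {1..n}" using pow[OF xy(1), of m] j by simp_all
    then have "(g ^^ m) x = y" using e(1) xy(2) by (meson inj_onD)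
    then show "y \<in> orbit g x" unfolding orbit_altdef_permutation[OF pg] by auto
  next
    assume "y \<in> orbit g x"
    then obtain m where "y = (g ^^ m) x" unfolding orbit_altdef_permutation[OF pg] by auto
    then have "e y = (f ^^ (k * m)) (e x)" using pow[OF xy(1), of m] by simp
    then show "e y \<in> orbit f (e x)" unfolding orbit_altdef_permutation[OF pf] by blast
  qed
  have eq: "orbit f (e x) = orbit f (e y) \<longleftrightarrow> orbit g x = orbit g y"
    if "x \<in> {1..n}" "y \<in> {1..n}" for x y
    using iff[OF that(2,1)] orbit_eq_iff_mem[OF pf] orbit_eq_iff_mem[OF pg] by metis
  define h where "h B = orbit f (e (SOME x. x \<in> B))" for B
  have h: "h (orbit g x) = orbit f (e x)" if x: "x \<in> {1..n}" for x
  proof -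
    define y where "y = (SOME y. y \<in> orbit g x)"
    have y: "y \<in> orbit g x" unfolding y_def by (rule someI[where x = "g x"]) (rule orbit.base)
    then have "y \<in> {1..n}" using permutes_orbit_subset[OF g x] by blast
    then show ?thesis
      unfolding h_def y_def[symmetric] using eq x y orbit_eq_iff_mem[OF pg] by metis
  qed
  have "orbit_partition N f = h ` orbit_partition n g"
  proof (intro equalityI subsetI)
    fix O' assume "O' \<in> orbit_partition N f"
    then obtain p where p: "p \<in> {1..N}" "O' = orbit f p" by (auto simp: orbit_partition_def)
    then obtain x where x: "x \<in> {1..n}" "e x \<in> orbit f p" using meets by blast
    then have "O' = h (orbit g x)" using h p(2) orbit_eq_iff_mem[OF pf] by metis
    then show "O' \<in> h ` orbit_partition n g" using orbit_partition_mem[OF x(1)] by simp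
  next
    fix O' assume "O' \<in> h ` orbit_partition n g"
    then obtain x where x: "x \<in> {1..n}" "O' = h (orbit g x)" by (auto simp: orbit_partition_def)
    then have "O' = orbit f (e x)" using h by simp
    then show "O' \<in> orbit_partition N f" using orbit_partition_mem e(2) x(1) by blast
  qed
  moreover have "inj_on h (orbit_partition n g)"
  proof (rule inj_onI)
    fix A B assume AB: "A \<in> orbit_partition n g" "B \<in> orbit_partition n g" "h A = h B"
    then obtain x y where "x \<in> {1..n}" "A = orbit g x" "y \<in> {1..n}" "B = orbit g y"
      by (auto simp: orbit_partition_def)
    then show "A = B" using AB(3) h eq by metis
  qed
  ultimately show ?thesis unfolding cycles_def by (simp add: card_image)
qed

context perm_list
begin

text \<open>The rotation \<open>C\<close> passes from one residue class to the next, and \<open>\<sigma>\<^sup>-\<^sup>1\<close> then applies the inverse of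
  the component that belongs to the class reached. Started in the last class, the steps multiply up
  to \<open>(d\<^sub>1 \<cdots> d\<^sub>j)\<^sup>-\<^sup>1 c\<close>.\<close>

abbreviation rot where "rot \<equiv> inv \<sigma> \<circ> coxeter (k * n)"

lemma prod_permutes: "prod_perm (take j ds) permutes {1..n}"
  by (rule prod_perm_permutes) (use perms in_set_takeD in fast)

lemma inv_prod_take_Suc:
  assumes "j < k"
  shows "inv (prod_perm (take (Suc j) ds)) x = inv (ds ! j) (inv (prod_perm (take j ds)) x)"
proof -
  have "take (Suc j) ds = take j ds @ [ds ! j]" using assms by (rule take_Suc_conv_app_nth)
  then have "prod_perm (take (Suc j) ds) = prod_perm (take j ds) \<circ> (ds ! j)" by simp
  then show ?thesis
    using o_inv_distrib[OF permutes_bij[OF prod_permutes[of j]] permutes_bij[OF nth_permutes[OF assms]]]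
    by simp
qed

lemma inv_shuffle_perm_slot:
  assumes "i < k" "x \<in> {1..n}"
  shows "inv \<sigma> (slot k i x) = slot k i (inv (ds ! i) x)"
proof (rule permutes_inv_eq[OF shuffle_perm_permutes, THEN iffD2])
  have "inv (ds ! i) x \<in> {1..n}"
    using permutes_in_image[OF permutes_inv[OF nth_permutes[OF assms(1)]]] assms(2) by blast
  from shuffle_perm_slot[OF assms(1) this]
  show "\<sigma> (slot k i (inv (ds ! i) x)) = slot k i x"
    by (simp add: permutes_inverses(1)[OF nth_permutes[OF assms(1)]])
qed

lemma coxeter_slot:
  assumes "i < k" "x \<in> {1..n}"
  shows "coxeter (k * n) (slot k i x)
    = (if Suc i < k then slot k (Suc i) x else slot k 0 (coxeter n x))"
proof -
  have m: "slot k i x \<in> {1..k * n}" using slot_mem_iff[of i k x n] assms by simp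
  show ?thesis
  proof (cases "Suc i < k")
    case True
    then have "slot k (Suc i) x \<in> {1..k * n}" using slot_mem_iff[of "Suc i" k x n] assms by simp
    then have "slot k i x < k * n" by (simp add: slot_def)
    then show ?thesis using True coxeter_apply[OF m] by (simp add: slot_def)
  next
    case False
    then have i: "k = Suc i" using assms(1) by simp
    obtain y where y: "x = Suc y" using assms(2) by (cases x) auto
    have s: "slot k i x = k * x" unfolding slot_def y i by simp
    have "k * x < k * n \<longleftrightarrow> x < n" using k_pos by simp
    then show ?thesis
      using False coxeter_apply[OF m] coxeter_apply[OF assms(2)] s by (simp add: slot_def One_nat_def)
  qed
qed

lemma rot_slot:
  assumes "i < k" "x \<in> {1..n}"
  shows "rot (slot k i x)
    = (if Suc i < k then slot k (Suc i) (inv (ds ! Suc i) x) else slot k 0 (inv (ds ! 0) (coxeter n x)))"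
proof -
  have "coxeter n x \<in> {1..n}" using permutes_in_image[OF coxeter_permutes] assms(2) by blast
  then show ?thesis
    using coxeter_slot[OF assms] inv_shuffle_perm_slot[OF _ assms(2)]
      inv_shuffle_perm_slot[OF k_pos, of "coxeter n x"] by simp
qed

lemma rot_permutes: "rot permutes {1..k * n}"
  by (intro permutes_compose coxeter_permutes permutes_inv shuffle_perm_permutes)

lemma slot_class_rot:
  assumes "p \<in> {1..k * n}"
  shows "slot_class k (rot p) = Suc (slot_class k p) mod k"
proof -
  obtain i x where ix: "i < k" "x \<in> {1..n}" "p = slot k i x" using slotE[OF k_pos assms] .
  show ?thesis
  proof (cases "Suc i < k")
    case True
    then show ?thesis unfolding ix(3) rot_slot[OF ix(1,2)] using ix(1) by simp
  next
    case False
    then have "Suc i = k" using ix(1) by simp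
    then show ?thesis unfolding ix(3) rot_slot[OF ix(1,2)] using ix(1) k_pos by simp
  qed
qed

lemma slot_class_rot_pow:
  assumes "p \<in> {1..k * n}"
  shows "(rot ^^ j) p \<in> {1..k * n} \<and> slot_class k ((rot ^^ j) p) = (slot_class k p + j) mod k"
proof (induction j)
  case 0
  then show ?case using assms k_pos by simp
next
  case (Suc j)
  define q where "q = (rot ^^ j) p"
  have q: "q \<in> {1..k * n}" "slot_class k q = (slot_class k p + j) mod k" using Suc by (simp_all only: q_def)
  have e: "(rot ^^ Suc j) p = rot q" by (simp only: funpow.simps o_apply q_def)
  show ?case
    unfolding e using permutes_in_image[OF rot_permutes, of q] q slot_class_rot[OF q(1)]
    by (simp only: add_Suc_right mod_Suc_eq simp_thms)
qed

lemma rot_pow_last_slot: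
  assumes x: "x \<in> {1..n}" and j: "j < k"
  shows "(rot ^^ Suc j) (slot k (k - 1) x) = slot k j (inv (prod_perm (take (Suc j) ds)) (coxeter n x))"
  using j
proof (induction j)
  case 0
  have "rot (slot k (k - 1) x) = slot k 0 (inv (ds ! 0) (coxeter n x))"
    using rot_slot[of "k - 1" x] x k_pos by (simp only: if_False diff_less less_numeral_extra Suc_diff_1 less_irrefl zero_less_one)
  moreover have "inv (prod_perm (take (Suc 0) ds)) (coxeter n x) = inv (ds ! 0) (coxeter n x)"
    using inv_prod_take_Suc[OF k_pos, of "coxeter n x"] by (simp only: take_0 prod_perm_simps inv_id id_apply)
  ultimately show ?case by (simp only: funpow.simps o_apply id_apply)
next
  case (Suc j)
  define y where "y = inv (prod_perm (take (Suc j) ds)) (coxeter n x)"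
  have y: "y \<in> {1..n}"
    unfolding y_def
    using permutes_in_image[OF permutes_inv[OF prod_permutes]] permutes_in_image[OF coxeter_permutes] x by blast
  have "(rot ^^ Suc (Suc j)) (slot k (k - 1) x) = rot ((rot ^^ Suc j) (slot k (k - 1) x))"
    by (simp only: funpow.simps o_apply)
  also have "\<dots> = rot (slot k j y)" using Suc by (simp only: y_def Suc_lessD)
  also have "\<dots> = slot k (Suc j) (inv (ds ! Suc j) y)"
    using rot_slot[of j y] y Suc.prems by (simp only: if_True Suc_lessD)
  also have "inv (ds ! Suc j) y = inv (prod_perm (take (Suc (Suc j)) ds)) (coxeter n x)"
    unfolding y_def using inv_prod_take_Suc[OF Suc.prems] by simp
  finally show ?case .
qed

lemma cycles_rot: "cycles (k * n) rot = cycles n (inv (prod_perm ds) \<circ> coxeter n)"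
proof (rule cycles_return_map[where e = "slot k (k - 1)" and k = k])
  have last: "k - 1 < k" using k_pos by simp
  show "rot permutes {1..k * n}" by (rule rot_permutes)
  show "inv (prod_perm ds) \<circ> coxeter n permutes {1..n}"
    using prod_permutes[of k] by (intro permutes_compose coxeter_permutes permutes_inv) simp
  show "inj_on (slot k (k - 1)) {1..n}"
    using strict_mono_on_imp_inj_on[OF slot_strict_mono[OF k_pos]] by (rule inj_on_subset) auto
  show "slot k (k - 1) ` {1..n} \<subseteq> {1..k * n}"
    using slot_mem_iff[OF last] by auto
  show "(rot ^^ k) (slot k (k - 1) x) = slot k (k - 1) ((inv (prod_perm ds) \<circ> coxeter n) x)"
    if "x \<in> {1..n}" for x
    using rot_pow_last_slot[OF that last] k_pos by (simp only: Suc_diff_1 take_all[OF order_refl] o_apply)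
  have S: "slot k (k - 1) x \<in> {1..k * n}" if "x \<in> {1..n}" for x
    using slot_mem_iff[OF last, of x n] that by simp
  show "k dvd j"
    if x: "x \<in> {1..n}" and e: "(rot ^^ j) (slot k (k - 1) x) = slot k (k - 1) y" for j x y
  proof -
    have "k - 1 = (k - 1 + j) mod k"
      using slot_class_rot_pow[OF S[OF x], of j] slot_class_slot[OF last] e by metis
    then have "(k - 1 + j) mod k = (k - 1) mod k" using mod_less[OF last] by metis
    then show ?thesis using mod_eq_dvd_iff_nat[of "k - 1" "k - 1 + j" k] by simp
  qed
  show "\<exists>x\<in>{1..n}. slot k (k - 1) x \<in> orbit rot p" if p: "p \<in> {1..k * n}" for p
  proof -
    define j where "j = k - 1 - slot_class k p"
    define q where "q = (rot ^^ j) p"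
    have q: "q \<in> {1..k * n}" "slot_class k q = (slot_class k p + j) mod k"
      unfolding q_def using slot_class_rot_pow[OF p] by blast+
    have "slot_class k p + j = k - 1"
      unfolding j_def using slot_class_less[OF k_pos, of p] by simp
    then have "slot_class k q = k - 1" using q(2) last by simp
    then have "slot k (k - 1) (slot_pos k q) = q" using slot_decompose[of q k] q(1) by simp
    moreover have "q \<in> orbit rot p"
      unfolding q_def
      by (rule funpow_in_orbit[OF permutation_self_in_orbit[OF permutation_of_permutes[OF rot_permutes]]])
    ultimately show ?thesis using slot_pos_mem[OF k_pos q(1)] by metis
  qed
qed

text \<open>\<open>\<sigma>\<close> has as many cycles as its components together, and \<open>\<sigma>\<^sup>-\<^sup>1 C\<close> as many as the return map;
  in terms of lengths, the \<open>kn - n\<close> additional points cancel.\<close>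

theorem abs_le_shuffle_perm_iff:
  "abs_le (k * n) \<sigma> (coxeter (k * n)) \<longleftrightarrow>
   (\<Sum>i<k. word_length n (ds ! i)) + word_length n (inv (prod_perm ds) \<circ> coxeter n)
     = word_length n (coxeter n)"
proof -
  define t where "t = rot"
  define r where "r = inv (prod_perm ds) \<circ> coxeter n"
  define s where "s = (\<Sum>i<k. word_length n (ds ! i))"
  have r: "r permutes {1..n}"
    unfolding r_def using prod_permutes[of k] by (intro permutes_compose coxeter_permutes permutes_inv) simp
  have t: "t permutes {1..k * n}" unfolding t_def by (rule rot_permutes)
  have c: "cycles (k * n) t = cycles n r" unfolding t_def r_def by (rule cycles_rot)
  have kn: "1 \<le> k * n" "n \<le> k * n" using n k_pos by (cases k; simp)+
  have "word_length (k * n) t + cycles n r = k * n" using word_length_plus_cycles[OF t] c by simp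
  moreover have "word_length n r + cycles n r = n" by (rule word_length_plus_cycles[OF r])
  moreover note word_length_coxeter[OF kn(1)] word_length_coxeter[OF n]
  ultimately have "word_length (k * n) (coxeter (k * n)) = s + word_length (k * n) t \<longleftrightarrow>
      s + word_length n r = word_length n (coxeter n)"
    using kn by linarith
  then show ?thesis
    unfolding abs_le_def word_length_shuffle_perm s_def[symmetric] t_def r_def .
qed

text \<open>Shuffling planar permutations preserves the property of moving cyclically upwards on each cycle,
  so that the orbits alone decide.\<close>

lemma noncrossing_shuffle_perm_iff:
  assumes "set ds \<subseteq> NC_perm n"
  shows "noncrossing (orbit_partition (k * n) \<sigma>) \<longleftrightarrow> \<sigma> \<in> NC_perm (k * n)"
proof -
  have "\<sigma> p = next_in (orbit \<sigma> p) p" if p: "p \<in> {1..k * n}" for p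
  proof -
    obtain i x where ix: "i < k" "x \<in> {1..n}" "p = slot k i x" using slotE[OF k_pos p] .
    have d: "ds ! i \<in> NC_perm n" using assms ix(1) nth_mem by blast
    have pd: "permutation (ds ! i)" by (rule permutation_of_permutes[OF nth_permutes[OF ix(1)]])
    have sub: "orbit (ds ! i) x \<subseteq> {1..}"
      using permutes_orbit_subset[OF nth_permutes[OF ix(1)] ix(2)] by auto
    have "\<sigma> p = slot k i ((ds ! i) x)" using shuffle_perm_slot ix by simp
    also have "(ds ! i) x = next_in (orbit (ds ! i) x) x"
      using planar_eq_next_in[OF pd] d by (simp add: NC_perm_iff)
    also have "slot k i \<dots> = next_in (slot k i ` orbit (ds ! i) x) (slot k i x)"
      by (rule next_in_image[symmetric, OF slot_strict_mono[OF k_pos] sub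
            finite_orbit_permutation[OF pd] permutation_self_in_orbit[OF pd]])
    finally show ?thesis using orbit_shuffle_perm[OF ix(1,2)] ix(3) by simp
  qed
  then show ?thesis using NC_perm_iff_next_in[OF shuffle_perm_permutes] by blast
qed

lemma shuffle_perm_in_NC_perm_iff:
  "\<sigma> \<in> NC_perm (k * n) \<longleftrightarrow>
   (\<Sum>i<k. word_length n (ds ! i)) + word_length n (inv (prod_perm ds) \<circ> coxeter n)
     = word_length n (coxeter n)"
  unfolding NC_perm_def using shuffle_perm_permutes id_abs_le abs_le_shuffle_perm_iff by blast

end


section \<open>The Kreweras complement of a noncrossing permutation\<close>

definition complement :: "nat \<Rightarrow> (nat \<Rightarrow> nat) \<Rightarrow> nat \<Rightarrow> nat" where
  "complement n w = inv w \<circ> coxeter n"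

lemma complement_permutes: "w permutes {1..n} \<Longrightarrow> complement n w permutes {1..n}"
  unfolding complement_def by (intro permutes_compose permutes_inv coxeter_permutes)

lemma NC_perm_iff_length:
  "w \<in> NC_perm n \<longleftrightarrow> w permutes {1..n} \<and>
     word_length n (coxeter n) = word_length n w + word_length n (complement n w)"
  unfolding NC_perm_def mem_Collect_eq
  unfolding complement_def abs_le_def[of n w "coxeter n"] by (simp only: id_abs_le simp_thms)

lemma comp_inv_cancel:
  assumes "w permutes S"
  shows "w \<circ> (inv w \<circ> f) = f" "inv w \<circ> (w \<circ> f) = f"
  using permutes_inv_o[OF assms] by (simp_all only: o_assoc id_comp)

lemma inv_complement:
  assumes "w permutes {1..n}"
  shows "inv (complement n w) = inv (coxeter n) \<circ> w"
  unfolding complement_def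
    o_inv_distrib[OF permutes_bij[OF permutes_inv[OF assms]] permutes_bij[OF coxeter_permutes]]
    permutes_inv_inv[OF assms] ..

lemma word_length_complement_quotient:
  assumes u: "u permutes {1..n}" and v: "v permutes {1..n}"
  shows "word_length n (inv (complement n v) \<circ> complement n u) = word_length n (inv u \<circ> v)"
proof -
  note c = coxeter_permutes[of n]
  define w where "w = v \<circ> complement n u"
  have w: "w permutes {1..n}"
    unfolding w_def by (rule permutes_compose[OF complement_permutes[OF u] v])
  have "inv (complement n v) \<circ> complement n u = inv (coxeter n) \<circ> w"
    unfolding inv_complement[OF v] w_def by (rule comp_assoc)
  then have "word_length n (inv (complement n v) \<circ> complement n u) = word_length n (w \<circ> inv (coxeter n))"
    using word_length_commute[OF permutes_inv[OF c] w] by metis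
  also have "w \<circ> inv (coxeter n) = v \<circ> inv u"
    unfolding w_def complement_def comp_assoc permutes_inv_o(1)[OF c] comp_id ..
  also have "word_length n (v \<circ> inv u) = word_length n (inv u \<circ> v)"
    by (rule word_length_commute[OF v permutes_inv[OF u]])
  finally show ?thesis .
qed

lemma complement_in_NC_perm:
  assumes "w \<in> NC_perm n"
  shows "complement n w \<in> NC_perm n"
proof -
  have w: "w permutes {1..n}" using assms by (rule NC_perm_permutes)
  have "word_length n (complement n (complement n w)) = word_length n w"
  proof -
    have "complement n (complement n w) = inv (complement n w) \<circ> complement n id"
      by (simp add: complement_def[of n "complement n w"] complement_def[of n id] inv_id)
    then show ?thesis
      using word_length_complement_quotient[OF permutes_id w] by (simp add: inv_id)
  qed
  then show ?thesis
    using assms complement_permutes[OF w] unfolding NC_perm_iff_length by (metis add.commute)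
qed

text \<open>The quotients \<open>(v\<^sup>-\<^sup>1 c)\<^sup>-\<^sup>1 (u\<^sup>-\<^sup>1 c) = c\<^sup>-\<^sup>1 v u\<^sup>-\<^sup>1 c\<close> and \<open>u\<^sup>-\<^sup>1 v\<close> are conjugate, hence of the same length.\<close>

lemma abs_le_complement_iff:
  assumes u: "u \<in> NC_perm n" and v: "v \<in> NC_perm n"
  shows "abs_le n (complement n v) (complement n u) \<longleftrightarrow> abs_le n u v"
proof -
  define a where "a = word_length n (inv u \<circ> v)"
  have "word_length n (inv (complement n v) \<circ> complement n u) = a"
    unfolding a_def using u v by (intro word_length_complement_quotient NC_perm_permutes)
  moreover have "word_length n u + word_length n (complement n u) = word_length n v + word_length n (complement n v)"
    using u v unfolding NC_perm_iff_length by simp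
  ultimately show ?thesis unfolding abs_le_def a_def[symmetric] by linarith
qed

lemma complement_inj:
  assumes u: "u permutes {1..n}" and v: "v permutes {1..n}" and "complement n u = complement n v"
  shows "u = v"
  using assms(3) inv_complement[OF u] inv_complement[OF v] comp_inv_cancel(1)[OF coxeter_permutes] by metis

lemma coxeter_comp_inv_in_NC_perm:
  assumes "w \<in> NC_perm n"
  shows "coxeter n \<circ> inv w \<in> NC_perm n" and "complement n (coxeter n \<circ> inv w) = w"
proof -
  have w: "w permutes {1..n}" using assms by (rule NC_perm_permutes)
  note c = coxeter_permutes[of n]
  have "inv (coxeter n \<circ> inv w) = w \<circ> inv (coxeter n)"
    unfolding o_inv_distrib[OF permutes_bij[OF c] permutes_bij[OF permutes_inv[OF w]]]
      permutes_inv_inv[OF w] ..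
  then show eq: "complement n (coxeter n \<circ> inv w) = w"
    unfolding complement_def by (simp only: comp_assoc permutes_inv_o(2)[OF c] comp_id)
  have "word_length n (coxeter n \<circ> inv w) = word_length n (complement n w)"
    unfolding complement_def by (intro word_length_commute permutes_inv w c)
  then show "coxeter n \<circ> inv w \<in> NC_perm n"
    using assms permutes_compose[OF permutes_inv[OF w] c] eq unfolding NC_perm_iff_length by simp
qed

lemma interleave_eq_shuffle: "interleave P Q = shuffle [P, Q]"
proof -
  have len: "length [P, Q] = 2" by simp
  have two: "{1..2::nat} = {1, 2}" by auto
  show ?thesis
    unfolding shuffle_def Let_def len two interleave_def by (simp add: numeral_2_eq_2 One_nat_def)
qed

lemma noncrossing_right_of_interleave:
  assumes "noncrossing (interleave P Q)"
  shows "noncrossing Q"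
  unfolding noncrossing_def
proof (intro notI, elim exE bexE conjE)
  fix a b c d B B'
  assume *: "B \<in> Q" "B' \<in> Q" "a < b" "b < c" "c < d" "B \<noteq> B'" "a \<in> B" "c \<in> B" "b \<in> B'" "d \<in> B'"
  let ?f = "\<lambda>x::nat. 2 * x"
  have "inj ?f" by (simp add: inj_on_def)
  then have "?f ` B \<noteq> ?f ` B'" using *(6) by (simp add: inj_image_eq_iff)
  moreover have "?f ` B \<in> interleave P Q" "?f ` B' \<in> interleave P Q"
    using *(1,2) by (auto simp: interleave_def)
  moreover have "?f a < ?f b" "?f b < ?f c" "?f c < ?f d" using *(3-5) by auto
  moreover have "?f a \<in> ?f ` B" "?f c \<in> ?f ` B" "?f b \<in> ?f ` B'" "?f d \<in> ?f ` B'"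
    using *(7-10) by (auto intro: imageI)
  ultimately have "\<exists>a b c d. \<exists>B\<in>interleave P Q. \<exists>B'\<in>interleave P Q. a < b \<and> b < c \<and> c < d \<and>
      B \<noteq> B' \<and> a \<in> B \<and> c \<in> B \<and> b \<in> B' \<and> d \<in> B'"
    by (intro exI[of _ "?f a"] exI[of _ "?f b"] exI[of _ "?f c"] exI[of _ "?f d"]
        bexI[of _ "?f ` B"] bexI[of _ "?f ` B'"] conjI)
  then show False using assms unfolding noncrossing_def by (elim notE)
qed

text \<open>The interleaving of two noncrossing permutations \<open>w\<close> and \<open>u\<close> is their shuffle; it is noncrossing
  iff the lengths of \<open>w\<close>, \<open>u\<close> and \<open>(w u)\<^sup>-\<^sup>1 c\<close> add up to that of \<open>c\<close>, that is, iff \<open>u\<close> lies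
  below \<open>w\<^sup>-\<^sup>1 c\<close>.\<close>

lemma noncrossing_interleave_iff:
  assumes n: "1 \<le> n" and w: "w \<in> NC_perm n" and u: "u \<in> NC_perm n"
  shows "noncrossing (interleave (orbit_partition n w) (orbit_partition n u)) \<longleftrightarrow>
    abs_le n u (complement n w)"
proof -
  have pw: "w permutes {1..n}" and pu: "u permutes {1..n}" using w u NC_perm_permutes by blast+
  interpret perm_list n "[w, u]" by unfold_locales (use n pw pu in auto)
  have "inv (prod_perm [w, u]) \<circ> coxeter n = inv u \<circ> complement n w"
    using o_inv_distrib[OF permutes_bij[OF pw] permutes_bij[OF pu]]
    by (simp only: prod_perm_simps comp_id complement_def comp_assoc)
  moreover have "(\<Sum>i<length [w, u]. word_length n ([w, u] ! i)) = word_length n w + word_length n u"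
    by (simp add: eval_nat_numeral)
  moreover have "noncrossing (interleave (orbit_partition n w) (orbit_partition n u)) \<longleftrightarrow>
      shuffle_perm n [w, u] \<in> NC_perm (length [w, u] * n)"
    using noncrossing_shuffle_perm_iff w u orbit_partition_shuffle_perm
    by (simp add: interleave_eq_shuffle)
  ultimately have "noncrossing (interleave (orbit_partition n w) (orbit_partition n u)) \<longleftrightarrow>
      word_length n w + word_length n u + word_length n (inv u \<circ> complement n w) = word_length n (coxeter n)"
    using shuffle_perm_in_NC_perm_iff by (simp only:)
  moreover have "word_length n (coxeter n) = word_length n w + word_length n (complement n w)"
    using w unfolding NC_perm_iff_length by blast
  ultimately show ?thesis unfolding abs_le_def by linarith
qed

theorem kreweras_orbit_partition:
  assumes n: "1 \<le> n" and w: "w \<in> NC_perm n"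
  shows "kreweras n (orbit_partition n w) = orbit_partition n (complement n w)"
  unfolding kreweras_def
proof (rule the_equality)
  let ?w' = "complement n w"
  have w': "?w' \<in> NC_perm n" using w by (rule complement_in_NC_perm)
  show *: "partition_on {1..n} (orbit_partition n ?w') \<and>
    noncrossing (interleave (orbit_partition n w) (orbit_partition n ?w')) \<and>
    (\<forall>R. partition_on {1..n} R \<and> noncrossing (interleave (orbit_partition n w) R) \<longrightarrow>
       refines {1..n} R (orbit_partition n ?w'))"
  proof (intro conjI allI impI)
    show "partition_on {1..n} (orbit_partition n ?w')"
      by (rule partition_on_orbit_partition[OF NC_perm_permutes[OF w']])
    show "noncrossing (interleave (orbit_partition n w) (orbit_partition n ?w'))"
      using noncrossing_interleave_iff[OF n w w'] abs_le_refl[OF NC_perm_permutes[OF w']] by blast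
    fix R assume R: "partition_on {1..n} R \<and> noncrossing (interleave (orbit_partition n w) R)"
    then have "R \<in> NC n" using noncrossing_right_of_interleave by (auto simp: NC_def)
    then obtain u where u: "u \<in> NC_perm n" "orbit_partition n u = R" by (rule exists_planar_perm)
    then have "abs_le n u ?w'" using R noncrossing_interleave_iff[OF n w u(1)] by simp
    then show "refines {1..n} R (orbit_partition n ?w')"
      using abs_le_iff_refines[OF u(1) w'] u(2) by simp
  qed
  fix Q assume "partition_on {1..n} Q \<and> noncrossing (interleave (orbit_partition n w) Q) \<and>
    (\<forall>R. partition_on {1..n} R \<and> noncrossing (interleave (orbit_partition n w) R) \<longrightarrow> refines {1..n} R Q)"
  then show "Q = orbit_partition n ?w'" using * by (intro refines_asym) blast+
qed

lemma kreweras_inv_orbit_partition: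
  assumes n: "1 \<le> n" and w: "w \<in> NC_perm n"
  shows "kreweras_inv n (orbit_partition n w) = orbit_partition n (coxeter n \<circ> inv w)"
  unfolding kreweras_inv_def
proof (rule the_inv_into_f_eq)
  show "inj_on (kreweras n) (NC n)"
  proof (rule inj_onI)
    fix P Q assume PQ: "P \<in> NC n" "Q \<in> NC n" "kreweras n P = kreweras n Q"
    obtain u where u: "u \<in> NC_perm n" "orbit_partition n u = P" using PQ(1) by (rule exists_planar_perm)
    obtain v where v: "v \<in> NC_perm n" "orbit_partition n v = Q" using PQ(2) by (rule exists_planar_perm)
    have "orbit_partition n (complement n u) = orbit_partition n (complement n v)"
      using PQ(3) u v kreweras_orbit_partition[OF n] by metis
    then have "complement n u = complement n v"
      using orbit_partition_inj complement_in_NC_perm u(1) v(1) by (meson inj_onD)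
    then show "P = Q" using complement_inj NC_perm_permutes u v by metis
  qed
  show "kreweras n (orbit_partition n (coxeter n \<circ> inv w)) = orbit_partition n w"
    using kreweras_orbit_partition[OF n] coxeter_comp_inv_in_NC_perm[OF w] by metis
  show "orbit_partition n (coxeter n \<circ> inv w) \<in> NC n"
    by (rule orbit_partition_in_NC[OF coxeter_comp_inv_in_NC_perm(1)[OF w]])
qed


section \<open>The relative Kreweras complement\<close>

lemma nth_elem_strict_mono:
  assumes "finite X"
  shows "strict_mono_on {1..card X} (nth_elem X)"
proof (rule strict_mono_onI)
  fix i j assume "i \<in> {1..card X}" "j \<in> {1..card X}" "i < j"
  then show "nth_elem X i < nth_elem X j"
    unfolding nth_elem_def
    by (intro sorted_wrt_nth_less[OF strict_sorted_list_of_set]) auto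
qed

lemma nth_elem_image:
  assumes "finite X"
  shows "nth_elem X ` {1..card X} = X"
proof -
  have "nth_elem X ` {1..card X} = (\<lambda>i. sorted_list_of_set X ! i) ` ((\<lambda>i. i - 1) ` {1..card X})"
    by (simp add: nth_elem_def image_image)
  also have "(\<lambda>i. i - 1) ` {1..card X} = {0..<card X}"
  proof (intro equalityI subsetI)
    fix x assume "x \<in> {0..<card X}"
    then have "x = Suc x - 1" "Suc x \<in> {1..card X}" by simp_all
    then show "x \<in> (\<lambda>i. i - 1) ` {1..card X}" by (rule image_eqI)
  qed auto
  also have "(\<lambda>i. sorted_list_of_set X ! i) ` {0..<card X} = set (sorted_list_of_set X)"
    using nth_image[of "card X" "sorted_list_of_set X"] by (simp add: atLeast0LessThan)
  finally show ?thesis using assms by simp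
qed

text \<open>Transport to \<open>[m]\<close> along an increasing enumeration \<open>e\<close> of a block \<open>N\<close> with \<open>m\<close> elements.\<close>

locale block_coordinates =
  fixes e :: "nat \<Rightarrow> nat" and m :: nat and N :: "nat set"
  assumes mono: "strict_mono_on {1..m} e" and image: "e ` {1..m} = N"
begin

abbreviation e' where "e' \<equiv> the_inv_into {1..m} e"

lemma inj: "inj_on e {1..m}"
  using mono by (rule strict_mono_on_imp_inj_on)

lemma e_e' [simp]: "y \<in> N \<Longrightarrow> e (e' y) = y"
  using f_the_inv_into_f[OF inj] image by simp

lemma e'_e [simp]: "i \<in> {1..m} \<Longrightarrow> e' (e i) = i"
  by (rule the_inv_into_f_f[OF inj])

lemma e_in: "i \<in> {1..m} \<Longrightarrow> e i \<in> N"
  using image by blast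

lemma e'_in: "y \<in> N \<Longrightarrow> e' y \<in> {1..m}"
  using the_inv_into_into[OF inj _ order_refl] image by simp

lemma e_less_iff: "i \<in> {1..m} \<Longrightarrow> j \<in> {1..m} \<Longrightarrow> e i < e j \<longleftrightarrow> i < j"
  using strict_mono_on_less[OF mono] by blast

lemma e_le_iff: "i \<in> {1..m} \<Longrightarrow> j \<in> {1..m} \<Longrightarrow> e i \<le> e j \<longleftrightarrow> i \<le> j"
  using strict_mono_on_less_eq[OF mono] by blast

definition pullback :: "(nat \<Rightarrow> nat) \<Rightarrow> nat \<Rightarrow> nat" where
  "pullback w i = (if i \<in> {1..m} then e' (w (e i)) else i)"

lemma pullback_in: "w ` N \<subseteq> N \<Longrightarrow> i \<in> {1..m} \<Longrightarrow> pullback w i \<in> {1..m}"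
  unfolding pullback_def using e'_in e_in by (simp only: if_True) blast

lemma e_pullback: "w ` N \<subseteq> N \<Longrightarrow> i \<in> {1..m} \<Longrightarrow> e (pullback w i) = w (e i)"
  unfolding pullback_def using e_in by (simp only: if_True) (blast intro: e_e')

lemma pullback_permutes:
  assumes w: "permutation w" "w ` N \<subseteq> N"
  shows "pullback w permutes {1..m}"
proof (rule inj_imp_permutes)
  show "inj_on (pullback w) {1..m}"
  proof (rule inj_onI)
    fix i j assume ij: "i \<in> {1..m}" "j \<in> {1..m}" "pullback w i = pullback w j"
    then have "w (e i) = w (e j)" using e_pullback[OF w(2)] by metis
    then have "e i = e j" using permutation_bijective[OF w(1)] by (metis bij_pointE)
    then show "i = j" using e'_e ij by metis
  qed
  show "pullback w i = i" if "i \<notin> {1..m}" for i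
    using that unfolding pullback_def by (rule if_not_P)
qed (use pullback_in[OF w(2)] in auto)

lemma image_orbit_pullback:
  assumes w: "permutation w" "w ` N \<subseteq> N" and i: "i \<in> {1..m}"
  shows "e ` orbit (pullback w) i = orbit w (e i)"
proof (rule orbit_inverse)
  show "i \<in> orbit (pullback w) i"
    by (rule permutation_self_in_orbit[OF permutation_of_permutes[OF pullback_permutes[OF w]]])
  show "w (e j) = e (pullback w j)" if "j \<in> orbit (pullback w) i" for j
    using permutes_orbit_subset[OF pullback_permutes[OF w] i] that
    by (intro e_pullback[OF w(2), symmetric]) blast
qed

lemma e_in_gap_iff:
  assumes w: "w ` N \<subseteq> N" and ij: "i \<in> {1..m}" "j \<in> {1..m}"
  shows "e j \<in> gap w (e i) \<longleftrightarrow> j \<in> gap (pullback w) i"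
  unfolding gap_def e_pullback[OF w ij(1), symmetric]
  using e_less_iff e_le_iff ij pullback_in[OF w ij(1)] by simp

lemma planar_pullback:
  assumes w: "permutation w" "w ` N \<subseteq> N" and pl: "planar w"
  shows "planar (pullback w)"
  unfolding planar_def
proof (intro allI subsetI)
  fix i z assume "z \<in> pullback w ` gap (pullback w) i"
  then obtain j where j: "j \<in> gap (pullback w) i" "z = pullback w j" by blast
  show "z \<in> gap (pullback w) i"
  proof (cases "i \<in> {1..m}")
    case True
    then have jm: "j \<in> {1..m}"
      using j(1) pullback_in[OF w(2) True] by (auto simp: gap_def split: if_splits)
    have "w (e j) \<in> gap w (e i)"
      using planar_gap_iff[OF w(1) pl] e_in_gap_iff[OF w(2) True jm] j(1) by blast
    then show ?thesis
      using e_in_gap_iff[OF w(2) True pullback_in[OF w(2) jm]] e_pullback[OF w(2) jm] j(2) by simp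
  next
    case False
    then have "pullback w i = i" unfolding pullback_def by (rule if_not_P)
    then show ?thesis using j by (simp add: gap_def)
  qed
qed

lemma pullback_in_NC_perm:
  assumes "permutation w" "w ` N \<subseteq> N" "planar w"
  shows "pullback w \<in> NC_perm m"
  unfolding NC_perm_iff using pullback_permutes planar_pullback assms by blast

lemma orbit_partition_pullback:
  assumes w: "permutation w" "w ` N \<subseteq> N"
  shows "orbit_partition m (pullback w) = (\<lambda>B. e' ` B) ` (orbit w ` N)"
proof -
  have "orbit (pullback w) i = e' ` orbit w (e i)" if i: "i \<in> {1..m}" for i
  proof -
    have "e' ` orbit w (e i) = (\<lambda>j. e' (e j)) ` orbit (pullback w) i"
      unfolding image_orbit_pullback[OF w i, symmetric] by (rule image_image)
    also have "\<dots> = (\<lambda>j. j) ` orbit (pullback w) i"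
      using permutes_orbit_subset[OF pullback_permutes[OF w] i]
      by (intro image_cong refl e'_e) blast
    finally show ?thesis by simp
  qed
  then have "orbit_partition m (pullback w) = (\<lambda>i. e' ` orbit w (e i)) ` {1..m}"
    unfolding orbit_partition_def by (intro image_cong refl)
  then show ?thesis unfolding image[symmetric] by (simp add: image_image)
qed

text \<open>On a single cycle of a noncrossing permutation, in increasing coordinates, the permutation
  is the long cycle.\<close>

lemma pullback_eq_coxeter:
  assumes w: "permutation w" "planar w" and N: "y \<in> N" "N = orbit w y"
  shows "pullback w = coxeter m"
proof -
  have wN: "w ` N \<subseteq> N" unfolding N(2) by (auto intro: orbit.step)
  have "orbit w z = N" if "z \<in> N" for z
    using that orbit_eq_iff_mem[OF w(1)] N(2) by simp
  then have "orbit w ` N = {N}" using N(1) by auto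
  moreover have "e' ` N = {1..m}"
    unfolding image[symmetric] image_image using e'_e by simp
  ultimately have "orbit_partition m (pullback w) = {{1..m}}"
    using orbit_partition_pullback[OF w(1) wN] by simp
  moreover have "orbit_partition m (coxeter m) = {{1..m}}"
    using orbit_partition_coxeter[of m] e'_in[OF N(1)] by simp
  ultimately show ?thesis
    using orbit_partition_inj[of m] pullback_in_NC_perm[OF w(1) wN w(2)] coxeter_in_NC_perm
    by (metis inj_onD)
qed

end

lemma block_coordinates_nth_elem: "finite N \<Longrightarrow> block_coordinates (nth_elem N) (card N) N"
  by unfold_locales (simp_all add: nth_elem_strict_mono nth_elem_image)

text \<open>In the coordinates of a block of \<open>v\<close>, the permutation \<open>v\<close> becomes the long cycle, so that the
  complement \<open>u\<^sup>-\<^sup>1 c\<close> in these coordinates is \<open>u\<^sup>-\<^sup>1 v\<close> on the block.\<close>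

lemma kreweras_on_orbit:
  assumes u: "permutation u" "planar u" and v: "permutation v" "planar v"
    and uv: "\<And>x. orbit u x \<subseteq> orbit v x" and N: "y \<in> N" "N = orbit v y"
  shows "kreweras_on N (orbit u ` N) = orbit (inv u \<circ> v) ` N"
proof -
  let ?m = "card N"
  have fin: "finite N" unfolding N(2) by (rule finite_orbit_permutation[OF v(1)])
  interpret block_coordinates "nth_elem N" ?m N by (rule block_coordinates_nth_elem[OF fin])
  have m: "1 \<le> ?m" using fin N(1) by (auto simp: Suc_le_eq card_gt_0_iff One_nat_def)
  have vN: "v ` N \<subseteq> N" unfolding N(2) by (auto intro: orbit.step)
  have uN: "u ` N \<subseteq> N"
  proof clarify
    fix x assume "x \<in> N"
    then have "orbit v x = N" using orbit_eq_iff_mem[OF v(1)] N(2) by simp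
    then show "u x \<in> N" using uv[of x] orbit.base[of u x] by blast
  qed
  define q where "q = complement ?m (pullback u)"
  have pu: "pullback u permutes {1..?m}" by (rule pullback_permutes[OF u(1) uN])
  have q: "q permutes {1..?m}" unfolding q_def by (rule complement_permutes[OF pu])
  have qe: "nth_elem N (q i) = (inv u \<circ> v) (nth_elem N i)" if i: "i \<in> {1..?m}" for i
  proof -
    have qi: "q i \<in> {1..?m}" using permutes_in_image[OF q] i by blast
    have "pullback u (q i) = pullback v i"
      unfolding q_def complement_def pullback_eq_coxeter[OF v N] o_apply
      by (rule permutes_inverses(1)[OF pu])
    then have "u (nth_elem N (q i)) = v (nth_elem N i)"
      using e_pullback[OF uN qi] e_pullback[OF vN i] by simp
    then show ?thesis using permutation_bijective[OF u(1)] by (simp add: bij_inv_eq_iff)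
  qed
  have "kreweras_on N (orbit u ` N) = (\<lambda>B. nth_elem N ` B) ` kreweras ?m (orbit_partition ?m (pullback u))"
    unfolding kreweras_on_def orbit_partition_pullback[OF u(1) uN] ..
  also have "kreweras ?m (orbit_partition ?m (pullback u)) = orbit_partition ?m q"
    unfolding q_def by (rule kreweras_orbit_partition[OF m pullback_in_NC_perm[OF u(1) uN u(2)]])
  also have "(\<lambda>B. nth_elem N ` B) ` orbit_partition ?m q = (\<lambda>i. orbit (inv u \<circ> v) (nth_elem N i)) ` {1..?m}"
    unfolding orbit_partition_def image_image
  proof (rule image_cong[OF refl], rule orbit_inverse)
    fix i assume i: "i \<in> {1..?m}"
    show "i \<in> orbit q i" by (rule permutation_self_in_orbit[OF permutation_of_permutes[OF q]])
    show "(inv u \<circ> v) (nth_elem N j) = nth_elem N (q j)" if "j \<in> orbit q i" for j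
      using permutes_orbit_subset[OF q i] that by (intro qe[symmetric]) blast
  qed
  also have "\<dots> = orbit (inv u \<circ> v) ` (nth_elem N ` {1..?m})"
    by (simp only: image_image)
  also have "nth_elem N ` {1..?m} = N" by (rule nth_elem_image[OF fin])
  finally show ?thesis .
qed

theorem kreweras_rel_orbit_partition:
  assumes u: "u \<in> NC_perm n" and v: "v \<in> NC_perm n" and le: "abs_le n u v"
  shows "kreweras_rel (orbit_partition n v) (orbit_partition n u) = orbit_partition n (inv u \<circ> v)"
proof -
  have p: "u permutes {1..n}" "planar u" "v permutes {1..n}" "planar v"
    using u v by (simp_all add: NC_perm_iff)
  have pu: "permutation u" and pv: "permutation v" using permutation_of_permutes p by blast+
  have uv: "orbit u x \<subseteq> orbit v x" for x by (rule abs_le_orbit_subset[OF le p(1,3)])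
  have U: "\<Union>(orbit_partition n v) = {1..n}"
    using partition_onD1[OF partition_on_orbit_partition[OF p(3)]] by simp
  have "kreweras_on N ((\<inter>) N ` orbit_partition n u - {{}}) = orbit (inv u \<circ> v) ` N"
    if N: "N \<in> orbit_partition n v" for N
  proof -
    obtain y where y: "y \<in> {1..n}" "N = orbit v y" using N by (auto simp: orbit_partition_def)
    have yN: "y \<in> N" unfolding y(2) by (rule permutation_self_in_orbit[OF pv])
    have sub: "orbit u x \<subseteq> N" if "x \<in> N" for x
    proof -
      have "orbit v x = N" using that y(2) orbit_eq_iff_mem[OF pv] by simp
      then show ?thesis using uv[of x] by simp
    qed
    have Nn: "N \<subseteq> {1..n}" using U N by blast
    have "(\<inter>) N ` orbit_partition n u - {{}} = orbit u ` N"
    proof (intro equalityI subsetI)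
      fix B assume "B \<in> (\<inter>) N ` orbit_partition n u - {{}}"
      then obtain x where x: "x \<in> {1..n}" "B = N \<inter> orbit u x" "B \<noteq> {}"
        unfolding orbit_partition_def by blast
      then obtain z where z: "z \<in> N" "z \<in> orbit u x" by blast
      then have "orbit u z = orbit u x" using orbit_eq_iff_mem[OF pu] by simp
      then have "B = orbit u z" using sub[OF z(1)] x(2) by blast
      then show "B \<in> orbit u ` N" using z(1) by blast
    next
      fix B assume "B \<in> orbit u ` N"
      then obtain x where x: "x \<in> N" "B = orbit u x" by blast
      then have "B = N \<inter> orbit u x" using sub by blast
      moreover have "orbit u x \<in> orbit_partition n u" using x Nn orbit_partition_mem by blast
      ultimately show "B \<in> (\<inter>) N ` orbit_partition n u - {{}}"
        using orbit_nonempty[of u x] x(2) by blast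
    qed
    then show ?thesis using kreweras_on_orbit[OF pu p(2) pv p(4) uv yN y(2)] by simp
  qed
  then have "kreweras_rel (orbit_partition n v) (orbit_partition n u)
      = (\<Union>N\<in>orbit_partition n v. orbit (inv u \<circ> v) ` N)"
    unfolding kreweras_rel_def by (intro SUP_cong refl)
  also have "\<dots> = orbit (inv u \<circ> v) ` {1..n}" unfolding U[symmetric] by blast
  finally show ?thesis unfolding orbit_partition_def .
qed


section \<open>Cycle lengths divisible by \<open>k\<close>\<close>

text \<open>Returning to \<open>p\<close> takes a number of steps that is divisible by \<open>k\<close>, because each step raises the
  residue by one; the first return occurs after as many steps as the cycle has points.\<close>

lemma card_dvd_orbit_step:
  assumes w: "w permutes {1..k * n}"
    and step: "\<And>p. p \<in> {1..k * n} \<Longrightarrow> slot_class k (w p) = Suc (slot_class k p) mod k"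
    and p: "p \<in> {1..k * n}"
  shows "k dvd card (orbit w p)"
proof -
  have k: "0 < k" using p by (cases k) auto
  have self: "p \<in> orbit w p" by (rule permutation_self_in_orbit[OF permutation_of_permutes[OF w]])
  define d where "d = funpow_dist1 w p p"
  have card: "card (orbit w p) = d"
    unfolding orbit_conv_funpow_dist1[OF self] card_image[OF inj_on_funpow_dist1[OF self]] d_def by simp
  have pow: "(w ^^ j) p \<in> {1..k * n} \<and> slot_class k ((w ^^ j) p) = (slot_class k p + j) mod k" for j
  proof (induction j)
    case 0
    then show ?case using p k by simp
  next
    case (Suc j)
    have "w ((w ^^ j) p) \<in> {1..k * n}" using Suc permutes_in_image[OF w] by blast
    moreover have "slot_class k (w ((w ^^ j) p)) = (slot_class k p + Suc j) mod k"
      using Suc step by (simp add: mod_Suc_eq)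
    ultimately show ?case by simp
  qed
  have "(w ^^ d) p = p" unfolding d_def by (rule funpow_dist1_prop[OF self])
  then have "slot_class k p = (slot_class k p + d) mod k" using pow[of d] by metis
  then have "(slot_class k p + d) mod k = slot_class k p mod k"
    using slot_class_less[OF k, of p] by simp
  then have "k dvd d" using mod_eq_dvd_iff_nat[of "slot_class k p" "slot_class k p + d" k] by simp
  then show ?thesis using card by simp
qed

text \<open>A gap of \<open>w\<close> is a union of cycles; so its size is divisible by \<open>k\<close> as soon as all cycle
  lengths are.\<close>

lemma slot_class_step_of_card_dvd:
  assumes w: "w \<in> NC_perm (k * n)" and k: "0 < k"
    and div: "\<And>B. B \<in> orbit_partition (k * n) w \<Longrightarrow> k dvd card B"
    and p: "p \<in> {1..k * n}"
  shows "slot_class k (w p) = Suc (slot_class k p) mod k"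
proof -
  have per: "w permutes {1..k * n}" and pl: "planar w" using w by (simp_all add: NC_perm_iff)
  have pw: "permutation w" by (rule permutation_of_permutes[OF per])
  have wp: "w p \<in> {1..k * n}" using permutes_in_image[OF per] p by blast
  have sub: "gap w p \<subseteq> {1..k * n}" using p wp by (auto simp: gap_def)
  have cover: "\<Union>(orbit w ` gap w p) = gap w p"
    using planar_orbit_gap[OF pw pl] permutation_self_in_orbit[OF pw] by blast
  have "k dvd card (\<Union>(orbit w ` gap w p))"
  proof (rule dvd_partition)
    show "finite (\<Union>(orbit w ` gap w p))" unfolding cover by (rule finite_subset[OF sub]) simp
    show "\<forall>c\<in>orbit w ` gap w p. k dvd card c"
      using div orbit_partition_mem sub by blast
    show "\<forall>c1\<in>orbit w ` gap w p. \<forall>c2\<in>orbit w ` gap w p. c1 \<noteq> c2 \<longrightarrow> c1 \<inter> c2 = {}"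
    proof (intro ballI impI)
      fix c1 c2 assume c: "c1 \<in> orbit w ` gap w p" "c2 \<in> orbit w ` gap w p" "c1 \<noteq> c2"
      then obtain x y where "c1 = orbit w x" "c2 = orbit w y" by blast
      then show "c1 \<inter> c2 = {}" using c(3) orbit_eq_iff_mem[OF pw] by (metis disjoint_iff)
    qed
  qed
  then have dvd: "k dvd card (gap w p)" unfolding cover .
  show ?thesis
  proof (cases "p < w p")
    case True
    then have "card (gap w p) = w p - p - 1" by (simp add: gap_def One_nat_def)
    then obtain t where "w p - p - 1 = k * t" using dvd by (auto elim: dvdE)
    then have "w p - 1 = Suc (p - 1) + k * t" using True p by simp
    then have "(w p - 1) mod k = Suc (p - 1) mod k" by (metis mod_mult_self2)
    then show ?thesis unfolding slot_class_def by (simp only: mod_Suc_eq)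
  next
    case False
    then have "card (gap w p) = Suc p - w p" by (simp add: gap_def)
    then obtain t where "Suc p - w p = k * t" using dvd by (auto elim: dvdE)
    then have "Suc (p - 1) = (w p - 1) + k * t" using False p wp by simp
    then have "Suc (p - 1) mod k = (w p - 1) mod k" by (metis mod_mult_self2)
    then show ?thesis unfolding slot_class_def by (simp only: mod_Suc_eq)
  qed
qed

lemma Suc_mod_inj:
  assumes "a < k" "b < k" "Suc a mod k = Suc b mod k"
  shows "a = b"
  using assms by (auto simp: mod_Suc split: if_splits)

context perm_list
begin

lemma slot_class_coxeter:
  assumes "p \<in> {1..k * n}"
  shows "slot_class k (coxeter (k * n) p) = Suc (slot_class k p) mod k"
proof -
  obtain i x where ix: "i < k" "x \<in> {1..n}" "p = slot k i x" using slotE[OF k_pos assms] .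
  show ?thesis
  proof (cases "Suc i < k")
    case True
    then show ?thesis unfolding ix(3) coxeter_slot[OF ix(1,2)] using ix(1) by simp
  next
    case False
    then have "Suc i = k" using ix(1) by simp
    then show ?thesis unfolding ix(3) coxeter_slot[OF ix(1,2)] using ix(1) k_pos by simp
  qed
qed

lemma slot_class_inv_shuffle_perm:
  assumes "p \<in> {1..k * n}"
  shows "slot_class k (inv \<sigma> p) = slot_class k p"
proof -
  obtain i x where ix: "i < k" "x \<in> {1..n}" "p = slot k i x" using slotE[OF k_pos assms] .
  then show ?thesis using inv_shuffle_perm_slot[OF ix(1,2)] by simp
qed

lemma card_dvd_coxeter_comp_inv_shuffle_perm:
  assumes "B \<in> orbit_partition (k * n) (coxeter (k * n) \<circ> inv \<sigma>)"
  shows "k dvd card B"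
proof -
  obtain p where p: "p \<in> {1..k * n}" "B = orbit (coxeter (k * n) \<circ> inv \<sigma>) p"
    using assms by (auto simp: orbit_partition_def)
  have "slot_class k ((coxeter (k * n) \<circ> inv \<sigma>) q) = Suc (slot_class k q) mod k" if "q \<in> {1..k * n}" for q
    using slot_class_coxeter slot_class_inv_shuffle_perm[OF that]
      permutes_in_image[OF permutes_inv[OF shuffle_perm_permutes]] that by (metis o_apply)
  then show ?thesis
    unfolding p(2)
    by (intro card_dvd_orbit_step[OF _ _ p(1)] permutes_compose coxeter_permutes permutes_inv
        shuffle_perm_permutes)
qed

lemma orbit_shuffle_perm_subset_iff:
  assumes es: "perm_list n es" and len: "length es = k"
  shows "(\<forall>p. orbit \<sigma> p \<subseteq> orbit (shuffle_perm n es) p) \<longleftrightarrow>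
    (\<forall>i<k. \<forall>x. orbit (ds ! i) x \<subseteq> orbit (es ! i) x)"
proof -
  interpret E: perm_list n es by (rule es)
  have inj: "inj_on (slot k i) {1..}" for i
    by (rule strict_mono_on_imp_inj_on[OF slot_strict_mono[OF k_pos]])
  have key: "orbit \<sigma> (slot k i x) \<subseteq> orbit (shuffle_perm n es) (slot k i x) \<longleftrightarrow>
      orbit (ds ! i) x \<subseteq> orbit (es ! i) x" if ix: "i < k" "x \<in> {1..n}" for i x
  proof -
    have i': "i < E.k" using ix(1) len by simp
    have "orbit (ds ! i) x \<subseteq> {1..n}" "orbit (es ! i) x \<subseteq> {1..n}"
      using permutes_orbit_subset[OF nth_permutes[OF ix(1)] ix(2)]
        permutes_orbit_subset[OF E.nth_permutes[OF i'] ix(2)] by blast+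
    then have "orbit (ds ! i) x \<subseteq> {1..}" "orbit (es ! i) x \<subseteq> {1..}" by auto
    then have "slot k i ` orbit (ds ! i) x \<subseteq> slot k i ` orbit (es ! i) x \<longleftrightarrow>
        orbit (ds ! i) x \<subseteq> orbit (es ! i) x"
      using inj_on_image_mem_iff[OF inj] by blast
    then show ?thesis
      using orbit_shuffle_perm[OF ix] E.orbit_shuffle_perm[OF i' ix(2)] len by simp
  qed
  show ?thesis
  proof (intro iffI allI impI)
    fix i x assume a: "\<forall>p. orbit \<sigma> p \<subseteq> orbit (shuffle_perm n es) p" "i < k"
    show "orbit (ds ! i) x \<subseteq> orbit (es ! i) x"
    proof (cases "x \<in> {1..n}")
      case True
      then show ?thesis using key a by blast
    next
      case False
      have i': "i < E.k" using a(2) len by simp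
      have "orbit (ds ! i) x = {x}" "orbit (es ! i) x = {x}"
        unfolding orbit_eq_singleton_iff
        by (rule permutes_not_in[OF nth_permutes[OF a(2)] False])
          (rule permutes_not_in[OF E.nth_permutes[OF i'] False])
      then show ?thesis by simp
    qed
  next
    fix p assume a: "\<forall>i<k. \<forall>x. orbit (ds ! i) x \<subseteq> orbit (es ! i) x"
    show "orbit \<sigma> p \<subseteq> orbit (shuffle_perm n es) p"
    proof (cases "p \<in> {1..k * n}")
      case True
      then obtain i x where "i < k" "x \<in> {1..n}" "p = slot k i x" using slotE[OF k_pos] by blast
      then show ?thesis using key a by blast
    next
      case False
      have "shuffle_perm n es permutes {1..k * n}" using E.shuffle_perm_permutes len by simp
      from permutes_not_in[OF this False] permutes_not_in[OF shuffle_perm_permutes False]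
      have "orbit \<sigma> p = {p}" "orbit (shuffle_perm n es) p = {p}"
        by (simp_all only: orbit_eq_singleton_iff)
      then show ?thesis by simp
    qed
  qed
qed

end

text \<open>A noncrossing permutation all of whose cycle lengths are divisible by \<open>k\<close> raises residues
  modulo \<open>k\<close> by one, as does the long cycle; so its complement preserves residues, which
  means that it is a shuffle.\<close>

lemma exists_shuffle_of_divisible:
  assumes n: "1 \<le> n" and k: "1 \<le> k" and w: "w \<in> NC_perm (k * n)"
    and div: "\<And>B. B \<in> orbit_partition (k * n) w \<Longrightarrow> k dvd card B"
  obtains ds where "perm_list n ds" "length ds = k" "shuffle_perm n ds = complement (k * n) w"
proof -
  define s where "s = complement (k * n) w"
  have per: "w permutes {1..k * n}" using w by (rule NC_perm_permutes)
  have s: "s permutes {1..k * n}" unfolding s_def by (rule complement_permutes[OF per])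
  have k0: "0 < k" using k by simp
  interpret I: perm_list n "replicate k id"
    by unfold_locales (use n k in \<open>auto simp: permutes_id\<close>)
  have len: "length (replicate k (id :: nat \<Rightarrow> nat)) = k" by simp
  have cls: "slot_class k (s p) = slot_class k p" if p: "p \<in> {1..k * n}" for p
  proof -
    have sp: "s p \<in> {1..k * n}" using permutes_in_image[OF s] p by blast
    have "w (s p) = coxeter (k * n) p"
      unfolding s_def complement_def o_apply by (rule permutes_inverses(1)[OF per])
    then have "Suc (slot_class k (s p)) mod k = Suc (slot_class k p) mod k"
      using slot_class_step_of_card_dvd[OF w k0 div sp] I.slot_class_coxeter p unfolding len by metis
    then show ?thesis using Suc_mod_inj slot_class_less[OF k0] by blast
  qed
  define d where "d i x = (if x \<in> {1..n} then slot_pos k (s (slot k i x)) else x)" for i x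
  have slot_in: "slot k i x \<in> {1..k * n}" if "i < k" "x \<in> {1..n}" for i x
    using slot_mem_iff[of i k x n] that by simp
  have slot_d: "slot k i (d i x) = s (slot k i x)" if ix: "i < k" "x \<in> {1..n}" for i x
  proof -
    have m: "s (slot k i x) \<in> {1..k * n}" using permutes_in_image[OF s] slot_in[OF ix] by blast
    have "slot_class k (s (slot k i x)) = i" using cls[OF slot_in[OF ix]] ix by simp
    then show ?thesis using slot_decompose[of "s (slot k i x)" k] m ix unfolding d_def by simp
  qed
  have d_in: "d i x \<in> {1..n}" if ix: "i < k" "x \<in> {1..n}" for i x
    using slot_pos_mem[OF k0] permutes_in_image[OF s] slot_in[OF ix] ix(2) unfolding d_def by simp
  have d: "d i permutes {1..n}" if i: "i < k" for i
  proof (rule inj_imp_permutes)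
    show "inj_on (d i) {1..n}"
    proof (rule inj_onI)
      fix x y assume xy: "x \<in> {1..n}" "y \<in> {1..n}" "d i x = d i y"
      then have "s (slot k i x) = s (slot k i y)" using slot_d[OF i] by metis
      then have "slot k i x = slot k i y" using permutes_inj[OF s] by (metis injD)
      then show "x = y" using slot_eq_iff[OF i i, of x y] xy by simp
    qed
    show "d i x = x" if "x \<notin> {1..n}" for x using that unfolding d_def by (rule if_not_P)
  qed (use d_in[OF i] in auto)
  have L: "perm_list n (map d [0..<k])"
    by unfold_locales (use n k d in auto)
  interpret D: perm_list n "map d [0..<k]" by (rule L)
  have "shuffle_perm n (map d [0..<k]) p = s p" for p
  proof (cases "p \<in> {1..k * n}")
    case True
    obtain i x where ix: "i < k" "x \<in> {1..n}" "p = slot k i x" using slotE[OF k0 True] .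
    then show ?thesis using D.shuffle_perm_slot[of i x] slot_d[OF ix(1,2)] by simp
  next
    case False
    then show ?thesis using permutes_not_in[OF s] permutes_not_in[OF D.shuffle_perm_permutes] by simp
  qed
  then have "shuffle_perm n (map d [0..<k]) = s" by (rule ext)
  then show ?thesis using that L s_def by simp
qed


section \<open>Multichains and their quotients\<close>

lemma NC_perm_down_closed:
  assumes "abs_le n u v" "u permutes {1..n}" "v \<in> NC_perm n"
  shows "u \<in> NC_perm n"
  using abs_le_planar[OF assms(1,2)] assms(2,3) by (simp add: NC_perm_iff)

text \<open>The quotient \<open>u\<^sup>-\<^sup>1 v\<close> lies below the complement \<open>u\<^sup>-\<^sup>1 c\<close>, with quotient \<open>v\<^sup>-\<^sup>1 c\<close>.\<close>

lemma quotient_in_NC_perm: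
  assumes u: "u \<in> NC_perm n" and v: "v \<in> NC_perm n" and le: "abs_le n u v"
  shows "inv u \<circ> v \<in> NC_perm n"
proof (rule NC_perm_down_closed)
  have pu: "u permutes {1..n}" and pv: "v permutes {1..n}" using u v NC_perm_permutes by blast+
  show p: "inv u \<circ> v permutes {1..n}" by (intro permutes_compose permutes_inv pu pv)
  show "complement n u \<in> NC_perm n" by (rule complement_in_NC_perm[OF u])
  have "inv (inv u \<circ> v) \<circ> complement n u = complement n v"
  proof -
    have "inv (inv u \<circ> v) = inv v \<circ> u"
      unfolding o_inv_distrib[OF permutes_bij[OF permutes_inv[OF pu]] permutes_bij[OF pv]]
        permutes_inv_inv[OF pu] ..
    then show ?thesis unfolding complement_def by (simp only: comp_assoc comp_inv_cancel(1)[OF pu])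
  qed
  moreover define a where "a = word_length n (inv u \<circ> v)"
  moreover have "word_length n v = word_length n u + a" using le unfolding abs_le_def a_def .
  moreover have "word_length n u + word_length n (complement n u) = word_length n v + word_length n (complement n v)"
    using u v unfolding NC_perm_iff_length by simp
  ultimately show "abs_le n (inv u \<circ> v) (complement n u)"
    unfolding abs_le_def by (simp only:)
qed

text \<open>Where subadditivity of the length is exhausted in total, it is exhausted at each step.\<close>

lemma sum_tight:
  fixes a b :: "nat \<Rightarrow> nat"
  assumes le: "\<And>i. i < k \<Longrightarrow> a (Suc i) \<le> a i + b i" and total: "a k = a 0 + (\<Sum>i<k. b i)"
    and i: "i < k"
  shows "a (Suc i) = a i + b i"
proof -
  have up: "a j \<le> a 0 + (\<Sum>i<j. b i)" if "j \<le> k" for j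
    using that
  proof (induction j)
    case (Suc j)
    then show ?case using le[of j] by simp
  qed simp
  have eq: "a j = a 0 + (\<Sum>i<j. b i)" if "j \<le> k" for j
    using that
  proof (induction rule: inc_induct)
    case (step j)
    then show ?case using le[of j] up[of j] by simp
  qed (rule total)
  show ?thesis using eq[of i] eq[of "Suc i"] i by simp
qed

locale multichain =
  fixes n k :: nat and ps :: "(nat \<Rightarrow> nat) list"
  assumes n: "1 \<le> n" and k: "1 \<le> k" and ps: "ps \<in> NC_perm_multichains n k"
begin

text \<open>Completing the multichain by \<open>c\<close> makes \<open>K({\<pi>\<^sub>k})\<close> a relative complement like the others.\<close>

abbreviation p where "p i \<equiv> (ps @ [coxeter n]) ! i"
abbreviation ds where "ds \<equiv> map (delta n ps) [0..<k]"

lemma length_ps: "length ps = k"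
  using ps by (simp add: NC_perm_multichains_def)

lemma p_less: "i < k \<Longrightarrow> p i = ps ! i"
  using length_ps by (simp add: nth_append)

lemma p_last: "p k = coxeter n"
  using length_ps by (simp add: nth_append)

lemma p_in: "i \<le> k \<Longrightarrow> p i \<in> NC_perm n"
proof (cases "i < k")
  case True
  then show ?thesis using ps p_less by (auto simp: NC_perm_multichains_def)
next
  case False
  then show "p i \<in> NC_perm n" if "i \<le> k" using that p_last coxeter_in_NC_perm by simp
qed

lemma p_permutes: "i \<le> k \<Longrightarrow> p i permutes {1..n}"
  using p_in NC_perm_permutes by blast

lemma p_le: "i < k \<Longrightarrow> abs_le n (p i) (p (Suc i))"
proof (cases "Suc i < k")
  case True
  then show ?thesis using ps p_less by (simp add: NC_perm_multichains_def)
next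
  case False
  assume "i < k"
  then have "Suc i = k" using False by simp
  then show ?thesis using p_in[of i] p_last by (simp add: NC_perm_def)
qed

lemma delta_in: "i < k \<Longrightarrow> delta n ps i \<in> NC_perm n"
  unfolding delta_def by (intro quotient_in_NC_perm p_in p_le) simp_all

lemma word_length_delta: "i < k \<Longrightarrow> word_length n (p (Suc i)) = word_length n (p i) + word_length n (delta n ps i)"
  using p_le unfolding abs_le_def delta_def .

sublocale D: perm_list n ds
  by unfold_locales (use n k delta_in NC_perm_permutes in auto)

lemma length_ds: "length ds = k"
  by simp

lemma prod_delta: "j \<le> k \<Longrightarrow> prod_perm (map (delta n ps) [0..<j]) = inv (p 0) \<circ> p j"
proof (induction j)
  case 0
  then show ?case using permutes_inv_o(2)[OF p_permutes[of 0]] by simp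
next
  case (Suc j)
  have "prod_perm (map (delta n ps) [0..<Suc j]) = prod_perm (map (delta n ps) [0..<j]) \<circ> delta n ps j"
    by simp
  also have "\<dots> = inv (p 0) \<circ> (p j \<circ> (inv (p j) \<circ> p (Suc j)))"
    using Suc unfolding delta_def by (simp only: comp_assoc Suc_leD)
  also have "\<dots> = inv (p 0) \<circ> p (Suc j)"
    unfolding comp_inv_cancel(1)[OF p_permutes[OF Suc_leD[OF Suc.prems]]] ..
  finally show ?case .
qed

lemma sum_word_length_delta: "(\<Sum>i<j. word_length n (delta n ps i)) + word_length n (p 0) = word_length n (p j)"
  if "j \<le> k"
  using that
proof (induction j)
  case (Suc j)
  then show ?case using word_length_delta[of j] by simp
qed simp

lemma shuffle_deltas_in_NC_perm: "shuffle_perm n ds \<in> NC_perm (k * n)"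
proof -
  have "prod_perm ds = complement n (p 0)"
    using prod_delta[of k] p_last by (simp only: order_refl complement_def)
  then have "inv (prod_perm ds) \<circ> coxeter n = inv (complement n (p 0)) \<circ> complement n id"
    by (simp add: complement_def[of n id] inv_id)
  then have "word_length n (inv (prod_perm ds) \<circ> coxeter n) = word_length n (p 0)"
    using word_length_complement_quotient[OF permutes_id p_permutes[of 0]] by (simp add: inv_id)
  moreover have "(\<Sum>i<length ds. word_length n (ds ! i)) = (\<Sum>i<k. word_length n (delta n ps i))"
    by simp
  ultimately show ?thesis
    using D.shuffle_perm_in_NC_perm_iff sum_word_length_delta[OF order_refl] p_last length_ds by metis
qed

text \<open>Its orbits will be the blocks of the image of the multichain.\<close>

definition image_perm :: "nat \<Rightarrow> nat" where
  "image_perm = coxeter (k * n) \<circ> inv (shuffle_perm n ds)"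

lemma image_perm_in: "image_perm \<in> NC_perm (k * n)" and complement_image_perm: "complement (k * n) image_perm = shuffle_perm n ds"
  unfolding image_perm_def by (rule coxeter_comp_inv_in_NC_perm[OF shuffle_deltas_in_NC_perm])+

lemma multichain_to_NC_div_eq: "multichain_to_NC_div n k ps = orbit_partition (k * n) image_perm"
proof -
  have kn: "1 \<le> k * n" using mult_le_mono[OF k n] by simp
  have "map (\<lambda>i. kreweras_rel (orbit_partition n (ps ! Suc i)) (orbit_partition n (ps ! i))) [0..<k - 1]
      @ [kreweras n (orbit_partition n (ps ! (k - 1)))] = map (orbit_partition n) ds"
  proof (rule nth_equalityI)
    show "length (map (\<lambda>i. kreweras_rel (orbit_partition n (ps ! Suc i)) (orbit_partition n (ps ! i))) [0..<k - 1]
      @ [kreweras n (orbit_partition n (ps ! (k - 1)))]) = length (map (orbit_partition n) ds)"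
      using k by simp
    fix i assume "i < length (map (\<lambda>i. kreweras_rel (orbit_partition n (ps ! Suc i)) (orbit_partition n (ps ! i))) [0..<k - 1]
      @ [kreweras n (orbit_partition n (ps ! (k - 1)))])"
    then have i: "i < k" using k by simp
    show "(map (\<lambda>i. kreweras_rel (orbit_partition n (ps ! Suc i)) (orbit_partition n (ps ! i))) [0..<k - 1]
      @ [kreweras n (orbit_partition n (ps ! (k - 1)))]) ! i = map (orbit_partition n) ds ! i"
    proof (cases "i < k - 1")
      case True
      then have "kreweras_rel (orbit_partition n (ps ! Suc i)) (orbit_partition n (ps ! i))
          = orbit_partition n (inv (p i) \<circ> p (Suc i))"
        using kreweras_rel_orbit_partition[OF p_in[of i] p_in[of "Suc i"] p_le[of i]] p_less by simp
      then show ?thesis using True i by (simp add: nth_append delta_def)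
    next
      case False
      then have ik: "i = k - 1" "Suc i = k" using i by simp_all
      have "kreweras n (orbit_partition n (ps ! i)) = orbit_partition n (inv (p i) \<circ> p (Suc i))"
        using kreweras_orbit_partition[OF n p_in[of i]] p_less[OF i] p_last ik(2) i
        by (simp add: complement_def)
      then show ?thesis using ik i by (simp add: nth_append delta_def)
    qed
  qed
  then show ?thesis
    unfolding multichain_to_NC_div_def image_perm_def
    using kreweras_inv_orbit_partition[OF kn shuffle_deltas_in_NC_perm]
      D.orbit_partition_shuffle_perm unfolding length_ds by metis
qed

lemma multichain_to_NC_div_in: "multichain_to_NC_div n k ps \<in> NC_div n k"
  unfolding multichain_to_NC_div_eq NC_div_def
  using orbit_partition_in_NC[OF image_perm_in] D.card_dvd_coxeter_comp_inv_shuffle_perm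
  unfolding image_perm_def length_ds by blast

end

text \<open>The order on the multichains says that the shuffles of the quotients are reversely ordered,
  and taking complements reverses the order once more.\<close>

lemma multichain_order_iff:
  assumes ps: "multichain n k ps" and qs: "multichain n k qs"
  shows "NC_perm_multichains_le n k ps qs \<longleftrightarrow>
    refines {1..k * n} (multichain_to_NC_div n k ps) (multichain_to_NC_div n k qs)"
proof -
  interpret P: multichain n k ps by (rule ps)
  interpret Q: multichain n k qs by (rule qs)
  have "NC_perm_multichains_le n k ps qs \<longleftrightarrow>
      (\<forall>i<k. \<forall>x. orbit (delta n qs i) x \<subseteq> orbit (delta n ps i) x)"
    unfolding NC_perm_multichains_le_def
    using abs_le_iff_refines[OF Q.delta_in P.delta_in]
      refines_orbit_partition_iff[OF NC_perm_permutes[OF Q.delta_in] NC_perm_permutes[OF P.delta_in]]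
    by simp
  also have "\<dots> \<longleftrightarrow> (\<forall>i<length Q.ds. \<forall>x. orbit (Q.ds ! i) x \<subseteq> orbit (P.ds ! i) x)"
    by simp
  also have "\<dots> \<longleftrightarrow> (\<forall>x. orbit (shuffle_perm n Q.ds) x \<subseteq> orbit (shuffle_perm n P.ds) x)"
    by (rule Q.D.orbit_shuffle_perm_subset_iff[symmetric, OF P.D.perm_list_axioms]) simp
  also have "\<dots> \<longleftrightarrow> abs_le (k * n) (shuffle_perm n Q.ds) (shuffle_perm n P.ds)"
    using abs_le_iff_refines[OF Q.shuffle_deltas_in_NC_perm P.shuffle_deltas_in_NC_perm]
      refines_orbit_partition_iff[OF NC_perm_permutes[OF Q.shuffle_deltas_in_NC_perm]
        NC_perm_permutes[OF P.shuffle_deltas_in_NC_perm]] by simp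
  also have "\<dots> \<longleftrightarrow> abs_le (k * n) P.image_perm Q.image_perm"
    using abs_le_complement_iff[OF P.image_perm_in Q.image_perm_in]
    unfolding P.complement_image_perm Q.complement_image_perm .
  also have "\<dots> \<longleftrightarrow> refines {1..k * n} (orbit_partition (k * n) P.image_perm) (orbit_partition (k * n) Q.image_perm)"
    by (rule abs_le_iff_refines[OF P.image_perm_in Q.image_perm_in])
  finally show ?thesis unfolding P.multichain_to_NC_div_eq Q.multichain_to_NC_div_eq .
qed

lemma multichain_le_antisym:
  assumes ps: "multichain n k ps" and qs: "multichain n k qs"
    and le: "NC_perm_multichains_le n k ps qs" "NC_perm_multichains_le n k qs ps"
  shows "ps = qs"
proof -
  interpret P: multichain n k ps by (rule ps)
  interpret Q: multichain n k qs by (rule qs)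
  have d: "delta n ps i = delta n qs i" if "i < k" for i
    using le that abs_le_antisym NC_perm_permutes[OF P.delta_in] NC_perm_permutes[OF Q.delta_in]
    unfolding NC_perm_multichains_le_def by blast
  have "P.p i = Q.p i" if "i \<le> k" for i
    using that
  proof (induction rule: inc_induct)
    case base
    show ?case using P.p_last Q.p_last by simp
  next
    case (step i)
    have Pp: "P.p i permutes {1..n}" and Qp: "Q.p i permutes {1..n}" and Pn: "P.p (Suc i) permutes {1..n}"
      using P.p_permutes Q.p_permutes step by simp_all
    have e: "inv (P.p i) \<circ> P.p (Suc i) = inv (Q.p i) \<circ> P.p (Suc i)"
      using d[of i] step unfolding delta_def by simp
    have "inv (P.p i) = inv (P.p i) \<circ> P.p (Suc i) \<circ> inv (P.p (Suc i))"
      unfolding comp_assoc permutes_inv_o(1)[OF Pn] comp_id ..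
    also have "\<dots> = inv (Q.p i)"
      unfolding e unfolding comp_assoc permutes_inv_o(1)[OF Pn] comp_id ..
    finally show ?case using permutes_inv_inv[OF Pp] permutes_inv_inv[OF Qp] by metis
  qed
  then show ?thesis
    using P.length_ps Q.length_ps P.p_less Q.p_less by (intro nth_equalityI) auto
qed

text \<open>The multichain with given quotients \<open>d\<^sub>1, \<dots>, d\<^sub>k\<close> must consist of the
  \<open>\<pi>\<^sub>i = c (d\<^sub>i \<cdots> d\<^sub>k)\<^sup>-\<^sup>1\<close>. By subadditivity \<open>\<ell>\<^sub>T(\<pi>\<^sub>i\<^sub>+\<^sub>1) \<le> \<ell>\<^sub>T(\<pi>\<^sub>i) + \<ell>\<^sub>T(d\<^sub>i)\<close>, and since the shuffle is
  noncrossing, these estimates add up to an equality; so each is one.\<close>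

lemma exists_multichain:
  assumes n: "1 \<le> n" and k: "1 \<le> k" and R: "R \<in> NC_div n k"
  shows "\<exists>ps\<in>NC_perm_multichains n k. multichain_to_NC_div n k ps = R"
proof -
  obtain w where w: "w \<in> NC_perm (k * n)" "orbit_partition (k * n) w = R"
    using R exists_planar_perm unfolding NC_div_def by blast
  have div: "k dvd card B" if "B \<in> orbit_partition (k * n) w" for B
    using R that w(2) unfolding NC_div_def by blast
  obtain ds where ds: "perm_list n ds" "length ds = k" "shuffle_perm n ds = complement (k * n) w"
    using exists_shuffle_of_divisible[OF n k w(1) div] .
  interpret perm_list n ds by (rule ds(1))
  note c = coxeter_permutes[of n]
  \<comment> \<open>\<open>E i\<close> is the product from the \<open>(i + 1)\<close>-st factor on; \<open>E k\<close> is empty, so that \<open>q k = c\<close>\<close>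
  define E where "E i = prod_perm (drop i ds)" for i
  define q where "q i = coxeter n \<circ> inv (E i)" for i
  have E: "E i permutes {1..n}" for i
    unfolding E_def by (rule prod_perm_permutes) (use perms in_set_dropD in fast)
  have q: "q i permutes {1..n}" for i
    unfolding q_def by (intro permutes_compose permutes_inv c E)
  have inv_q: "inv (q i) = E i \<circ> inv (coxeter n)" for i
    unfolding q_def o_inv_distrib[OF permutes_bij[OF c] permutes_bij[OF permutes_inv[OF E]]]
      permutes_inv_inv[OF E] ..
  have "drop k ds = []" using ds(2) by simp
  then have qk: "q k = coxeter n" unfolding q_def E_def by (simp only: prod_perm_simps inv_id comp_id)
  have quot: "inv (q i) \<circ> q (Suc i) = ds ! i" if i: "i < k" for i
  proof -
    have "E i = ds ! i \<circ> E (Suc i)" unfolding E_def using Cons_nth_drop_Suc[of i ds] i ds(2) prod_perm_simps(2) by metis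
    then show ?thesis
      unfolding inv_q unfolding q_def comp_assoc comp_inv_cancel(2)[OF c]
      by (simp only: comp_assoc permutes_inv_o(1)[OF E] comp_id)
  qed
  define a where "a i = word_length n (q i)" for i
  define b where "b i = word_length n (ds ! i)" for i
  have step: "a (Suc i) \<le> a i + b i" if i: "i < k" for i
  proof -
    have "q (Suc i) = q i \<circ> (ds ! i)"
      unfolding quot[OF i, symmetric] by (rule comp_inv_cancel(1)[OF q, symmetric])
    then show ?thesis
      unfolding a_def b_def using word_length_comp_le[OF q nth_permutes, of i i] i ds(2) by simp
  qed
  have a0: "word_length n (inv (prod_perm ds) \<circ> coxeter n) = a 0"
    using word_length_commute[OF c permutes_inv[OF E[of 0]]] unfolding a_def q_def E_def by (simp only: drop_0)
  have "shuffle_perm n ds \<in> NC_perm (length ds * n)"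
    using complement_in_NC_perm[OF w(1)] unfolding ds(2,3) .
  then have "(\<Sum>i<k. b i) + a 0 = a k"
    unfolding shuffle_perm_in_NC_perm_iff a0 b_def[symmetric] unfolding a_def qk ds(2) .
  then have "a k = a 0 + (\<Sum>i<k. b i)" by simp
  then have tight: "a (Suc i) = a i + b i" if "i < k" for i
    using sum_tight[of k a b, OF step] that by blast
  have le: "abs_le n (q i) (q (Suc i))" if "i < k" for i
    using tight[OF that] unfolding abs_le_def quot[OF that] a_def b_def .
  have qin: "q i \<in> NC_perm n" if "i \<le> k" for i
    using that
  proof (induction rule: inc_induct)
    case base
    show ?case unfolding qk by (rule coxeter_in_NC_perm)
  next
    case (step i)
    show ?case by (rule NC_perm_down_closed[OF le[OF step(2)] q step(3)])
  qed
  define ps where "ps = map q [0..<k]"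
  have ps: "ps \<in> NC_perm_multichains n k"
    unfolding NC_perm_multichains_def ps_def using le qin ds(2) by auto
  interpret M: multichain n k ps by unfold_locales (use n k ps ds(2) in auto)
  have p: "(ps @ [coxeter n]) ! i = q i" if "i \<le> k" for i
    using that qk ds(2) unfolding ps_def by (auto simp: nth_append)
  have "delta n ps i = ds ! i" if "i < k" for i
    unfolding delta_def using p[of i] p[of "Suc i"] quot[OF that] that by simp
  then have "M.ds = ds" using ds(2) by (intro nth_equalityI) auto
  then have "complement (k * n) M.image_perm = complement (k * n) w"
    using M.complement_image_perm ds(3) by simp
  then have "M.image_perm = w"
    using complement_inj NC_perm_permutes[OF M.image_perm_in] NC_perm_permutes[OF w(1)] ds(2) by blast
  then show ?thesis using M.multichain_to_NC_div_eq w(2) ps ds(2) by metis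
qed


section \<open>The isomorphism\<close>

theorem theorem4p3p8:
  fixes n k :: nat
  assumes "n \<ge> 1" and "k \<ge> 1"
  shows "poset_iso
           (NC_perm_multichains n k) (NC_perm_multichains_le n k)
           (NC_div n k) (refines {1..k * n})
           (multichain_to_NC_div n k)"
proof -
  let ?A = "NC_perm_multichains n k" and ?B = "NC_div n k" and ?f = "multichain_to_NC_div n k"
  have M: "multichain n k ps" if "ps \<in> ?A" for ps
    using that assms by unfold_locales auto
  have iff: "NC_perm_multichains_le n k x y \<longleftrightarrow> refines {1..k * n} (?f x) (?f y)" if "x \<in> ?A" "y \<in> ?A" for x y
    using multichain_order_iff M that by blast
  have into: "?f x \<in> ?B" if "x \<in> ?A" for x
    using multichain.multichain_to_NC_div_in M that by blast
  have refl: "refines {1..k * n} R R" if "R \<in> ?B" for R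
    using that refines_refl unfolding NC_div_def NC_def by blast
  have bij: "bij_betw ?f ?A ?B"
    unfolding bij_betw_def
  proof (intro conjI inj_onI equalityI subsetI)
    fix x y assume xy: "x \<in> ?A" "y \<in> ?A" "?f x = ?f y"
    then have "NC_perm_multichains_le n k x y" "NC_perm_multichains_le n k y x"
      using iff refl into by metis+
    then show "x = y" using multichain_le_antisym M xy by blast
  qed (use into exists_multichain[OF assms] in \<open>fastforce+\<close>)
  have "partial_order_on ?B {(x, y). x \<in> ?B \<and> y \<in> ?B \<and> refines {1..k * n} x y}"
    unfolding partial_order_on_def preorder_on_def refl_on_def trans_def antisym_def
    using refl refines_trans refines_asym by blast
  moreover have "partial_order_on ?A {(x, y). x \<in> ?A \<and> y \<in> ?A \<and> NC_perm_multichains_le n k x y}"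
  proof -
    have "NC_perm_multichains_le n k x x" if "x \<in> ?A" for x using that iff refl into by blast
    moreover have "NC_perm_multichains_le n k x z"
      if "x \<in> ?A" "y \<in> ?A" "z \<in> ?A" "NC_perm_multichains_le n k x y" "NC_perm_multichains_le n k y z"
      for x y z using that iff refines_trans by blast
    moreover have "x = y"
      if "x \<in> ?A" "y \<in> ?A" "NC_perm_multichains_le n k x y" "NC_perm_multichains_le n k y x" for x y
      using that multichain_le_antisym M by blast
    ultimately show ?thesis
      unfolding partial_order_on_def preorder_on_def refl_on_def trans_def antisym_def by blast
  qed
  ultimately show ?thesis unfolding poset_iso_def using bij iff by blast
qed

end
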